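(* Let $0<p<q<\infty$ and let $\mu$ be a finite positive Borel measure on $\overline{\mathbb{D}}$. Let $\nu=\mu|_{\partial\mathbb{D}}$, let $\nu^a$ be the absolutely continuous part of $\nu$ with respect to normalized Lebesgue measure $m$ on $\mathbb{T}=\partial\mathbb{D}$, and let $\beta=d\nu^a/dm$. Then $\mu$ is a $q$-reverse Carleson measure for $H^p(\mathbb{D})$, i.e. there is $C>0$ with $\|f\|_{H^p}\le C\|f\|_{L^q(\overline{\mathbb{D}},\mu)}$ for all $f\in H^p(\mathbb{D})\cap C(\overline{\mathbb{D}})$, if and only if $\frac1\beta\in L^{\frac{p}{q-p}}(\mathbb{T},m)$ (in particular $\beta>0$ $m$-a.e., with $1/\beta=+\infty$ where $\beta=0$).
   Context: $H^p=H^p(\mathbb{D})$ ($0<p<\infty$) is the space of holomorphic $f$ on the unit disc $\mathbb{D}$ with $\|f\|_{H^p}^p=\sup_{0<r<1}\int_0^1|f(re^{2\pi it})|^p\,dt<\infty$. *)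

theory Defs
  imports "HOL-Analysis.Analysis"
begin

definition circle_mean :: "real \<Rightarrow> (complex \<Rightarrow> complex) \<Rightarrow> real \<Rightarrow> real" where
  "circle_mean p f r = integral {0..1} (\<lambda>t. norm (f (of_real r * cis (2 * pi * t))) powr p)"

definition hardy :: "real \<Rightarrow> (complex \<Rightarrow> complex) set" where
  "hardy p = {f. f holomorphic_on ball 0 1 \<and> bdd_above (circle_mean p f ` {0<..<1})}"

definition hardy_norm :: "real \<Rightarrow> (complex \<Rightarrow> complex) \<Rightarrow> real" where
  "hardy_norm p f = (SUP r\<in>{0<..<1}. circle_mean p f r) powr (1 / p)"

definition Lq_norm :: "complex measure \<Rightarrow> real \<Rightarrow> (complex \<Rightarrow> complex) \<Rightarrow> real" where
  "Lq_norm \<mu> q f = enn2real (\<integral>\<^sup>+ z\<in>cball 0 1. ennreal (norm (f z) powr q) \<partial>\<mu>) powr (1 / q)"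

definition circle_measure :: "complex measure" where
  "circle_measure = distr (restrict_space lborel {0::real..1}) borel (\<lambda>t. cis (2 * pi * t))"

definition restrict_to_circle :: "complex measure \<Rightarrow> complex measure" where
  "restrict_to_circle \<mu> = density \<mu> (indicator (sphere 0 1))"

text \<open>beta is (a version of) the density d nu^a / dm of the absolutely continuous part
  in the Lebesgue decomposition nu = nu^a + nu^s of nu with respect to m:
  nu^a = beta m, and nu^s is concentrated on an m-null Borel set N.\<close>
definition is_ac_part_density :: "complex measure \<Rightarrow> complex measure \<Rightarrow> (complex \<Rightarrow> real) \<Rightarrow> bool" where
  "is_ac_part_density m \<nu> \<beta> \<longleftrightarrow>
     \<beta> \<in> borel_measurable borel \<and> (\<forall>x. 0 \<le> \<beta> x) \<and>
     (\<exists>N\<in>sets borel. emeasure m N = 0 \<and>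
        (\<forall>A\<in>sets borel. emeasure \<nu> A = (\<integral>\<^sup>+ x\<in>A. ennreal (\<beta> x) \<partial>m) + emeasure \<nu> (A \<inter> N)))"

definition reverse_carleson :: "real \<Rightarrow> real \<Rightarrow> complex measure \<Rightarrow> bool" where
  "reverse_carleson p q \<mu> \<longleftrightarrow>
     (\<exists>C>0. \<forall>f. f \<in> hardy p \<and> continuous_on (cball 0 1) f \<longrightarrow>
              hardy_norm p f \<le> C * Lq_norm \<mu> q f)"

end

theory Submission
  imports Defs "HOL-Complex_Analysis.Complex_Analysis"
begin

text \<open>
  Sufficiency: with \<open>E = \<integral>|f|\<^sup>q d\<mu>\<close>, \<open>X = |f|\<^sup>q \<beta> / E\<close> and \<open>Y = \<beta> powr (- p / (q - p))\<close>, one has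
  \<open>|f|\<^sup>p = E powr (p/q) * X powr (p/q) * Y powr (1 - p/q) \<le> E powr (p/q) * (X + Y)\<close> on the circle, and
  \<open>X + Y\<close> has integral at most \<open>1 + \<integral>Y dm\<close>. The circle norm controls the Hardy norm because
  \<open>|f|\<^sup>p\<close> is subharmonic.

  Necessity: functions \<open>|f|\<^sup>p = exp (Re P)\<close> with \<open>P\<close> a polynomial approximate every positive continuous
  function on the circle. Testing with \<open>z ^ N * f\<close> and letting \<open>N\<close> tend to infinity removes the
  mass of \<open>\<mu>\<close> in the open disc, so \<open>\<integral>u dm \<le> C\<^sup>p (\<integral>u powr (q/p) d\<nu>) powr (p/q)\<close> for positive continuous \<open>u\<close>,
  hence for bounded Borel \<open>u \<ge> 0\<close>. Applied to truncations of \<open>\<beta> powr (- p / (q - p))\<close>, set to zero on the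
  null set carrying the singular part of \<open>\<nu>\<close>, this bounds their integrals uniformly.
\<close>

section \<open>Means of functions continuous up to the circle\<close>

text \<open>Near a maximum \<open>w0\<close> choose branches \<open>g k\<close> of \<open>f k powr p\<close> that are positive at \<open>w0\<close>: the
  holomorphic function \<open>\<Sum>k. g k\<close> is dominated by \<open>\<Sum>k. |f k| powr p\<close> with equality at \<open>w0\<close>, so its
  modulus has a local maximum there and it is constant.\<close>

lemma sum_norm_powr_locally_constant_at_max:
  fixes f :: "'i \<Rightarrow> complex \<Rightarrow> complex"
  assumes "finite I" "open S" "w0 \<in> S" "0 < p"
    and hol: "\<And>k. k \<in> I \<Longrightarrow> f k holomorphic_on S"
    and max: "\<And>w. w \<in> S \<Longrightarrow> (\<Sum>k\<in>I. norm (f k w) powr p) \<le> (\<Sum>k\<in>I. norm (f k w0) powr p)"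
  shows "\<exists>e>0. \<forall>w\<in>ball w0 e. (\<Sum>k\<in>I. norm (f k w) powr p) = (\<Sum>k\<in>I. norm (f k w0) powr p)"
proof -
  define u where "u w = (\<Sum>k\<in>I. norm (f k w) powr p)" for w
  \<comment> \<open>Indices with \<open>f k w0 = 0\<close> contribute nothing at \<open>w0\<close>
    and are dropped. For the others the quotient \<open>f k w / f k w0\<close> is kept within
    distance 1 of 1, so it avoids the cut of the principal power.\<close>
  define J where "J = {k\<in>I. f k w0 \<noteq> 0}"
  have fin: "finite J" using \<open>finite I\<close> by (simp add: J_def)
  have "\<forall>\<^sub>F w in nhds w0. w \<in> S \<and> (\<forall>k\<in>J. norm (f k w / f k w0 - 1) < 1)"
  proof (intro eventually_conj eventually_ball_finite fin ballI)
    show "\<forall>\<^sub>F w in nhds w0. w \<in> S"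
      using assms by (simp add: eventually_nhds_in_open)
    fix k assume k: "k \<in> J"
    have "isCont (f k) w0"
      using k holomorphic_on_imp_continuous_on[OF hol[of k]] assms(2,3)
      by (auto simp: J_def continuous_on_eq_continuous_at)
    then have "((\<lambda>w. norm (f k w / f k w0 - 1)) \<longlongrightarrow> norm (f k w0 / f k w0 - 1)) (nhds w0)"
      using k by (intro tendsto_intros) (auto simp: J_def isCont_def tendsto_nhds_iff)
    then show "\<forall>\<^sub>F w in nhds w0. norm (f k w / f k w0 - 1) < 1"
      using k by (intro order_tendstoD) (auto simp: J_def)
  qed
  then obtain e where e: "e > 0" "\<And>w. w \<in> ball w0 e \<Longrightarrow> w \<in> S"
      "\<And>w k. w \<in> ball w0 e \<Longrightarrow> k \<in> J \<Longrightarrow> norm (f k w / f k w0 - 1) < 1"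
    unfolding eventually_nhds_metric by (auto simp: dist_commute)
  have nonpos: "f k w / f k w0 \<notin> \<real>\<^sub>\<le>\<^sub>0" if "w \<in> ball w0 e" "k \<in> J" for w k
  proof
    assume "f k w / f k w0 \<in> \<real>\<^sub>\<le>\<^sub>0"
    then obtain x where "f k w / f k w0 = of_real x" "x \<le> 0" by (auto elim: nonpos_Reals_cases)
    then have "f k w / f k w0 - 1 = of_real (x - 1)" by simp
    then have "norm (f k w / f k w0 - 1) = 1 - x" using \<open>x \<le> 0\<close> by (simp only: norm_of_real)
    then show False using e(3)[OF that] \<open>x \<le> 0\<close> by simp
  qed
  define G where "G w = (\<Sum>k\<in>J. of_real (norm (f k w0) powr p) * (f k w / f k w0) powr of_real p)" for w
  have nG: "norm (of_real (norm (f k w0) powr p) * (f k w / f k w0) powr of_real p) = norm (f k w) powr p"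
    if "k \<in> J" for k w
    using that by (simp add: norm_mult norm_powr_real_powr' norm_divide powr_divide J_def)
  have Gu: "norm (G w) \<le> u w" for w
  proof -
    have "norm (G w) \<le> (\<Sum>k\<in>J. norm (f k w) powr p)"
      unfolding G_def by (rule sum_norm_le) (simp add: nG)
    also have "\<dots> \<le> u w"
      unfolding u_def by (rule sum_mono2) (use \<open>finite I\<close> in \<open>auto simp: J_def\<close>)
    finally show ?thesis .
  qed
  have G0: "G w0 = of_real (u w0)"
  proof -
    have "u w0 = (\<Sum>k\<in>J. norm (f k w0) powr p)"
      unfolding u_def by (rule sum.mono_neutral_right) (use \<open>finite I\<close> in \<open>auto simp: J_def\<close>)
    then show ?thesis by (simp add: G_def J_def)
  qed
  have u0: "u w0 \<ge> 0" by (simp add: u_def sum_nonneg)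
  have "G constant_on ball w0 e"
  proof (rule maximum_modulus_principle[where U = "ball w0 e" and \<xi> = w0])
    show "G holomorphic_on ball w0 e"
      unfolding G_def
    proof (intro holomorphic_intros)
      fix k assume k: "k \<in> J"
      show "f k holomorphic_on ball w0 e"
        using hol[of k] k e(2) by (auto simp: J_def intro: holomorphic_on_subset)
    qed (auto simp: J_def nonpos)
    show "norm (G z) \<le> norm (G w0)" if "z \<in> ball w0 e" for z
      using order_trans[OF Gu max[OF e(2)[OF that], folded u_def]] u0 by (simp add: G0)
  qed (use e in auto)
  then have "G w = G w0" if "w \<in> ball w0 e" for w
    using that e(1) by (auto simp: constant_on_def)
  then have "u w0 \<le> u w" if "w \<in> ball w0 e" for w
    using Gu[of w] that u0 by (simp add: G0)
  then show ?thesis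
    using max e unfolding u_def by (intro exI[of _ e]) (auto intro!: antisym)
qed

text \<open>The maximum points in the closed disc form a compact set; one of largest modulus must
  lie on the circle, since at an interior one local constancy would allow a step further
  outwards.\<close>

lemma sum_norm_powr_max_principle:
  fixes f :: "'i \<Rightarrow> complex \<Rightarrow> complex"
  assumes "finite I" "0 < p" "w \<in> cball 0 1"
    and hol: "\<And>k. k \<in> I \<Longrightarrow> f k holomorphic_on ball 0 1"
    and cont: "\<And>k. k \<in> I \<Longrightarrow> continuous_on (cball 0 1) (f k)"
  shows "\<exists>z\<in>sphere 0 1. (\<Sum>k\<in>I. norm (f k w) powr p) \<le> (\<Sum>k\<in>I. norm (f k z) powr p)"
proof -
  define u where "u w = (\<Sum>k\<in>I. norm (f k w) powr p)" for w
  have cu: "continuous_on (cball 0 1) u"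
    unfolding u_def using cont \<open>0 < p\<close> by (intro continuous_intros continuous_on_powr') auto
  obtain a where a: "a \<in> cball 0 1" "\<And>z. z \<in> cball 0 1 \<Longrightarrow> u z \<le> u a"
    using continuous_attains_sup[OF compact_cball _ cu] by auto
  define A where "A = {z \<in> cball 0 1. u z = u a}"
  have "closed A"
    unfolding A_def using continuous_closed_preimage[OF cu closed_cball closed_singleton[of "u a"]]
    by (simp add: vimage_def Int_def)
  then have "compact A"
    by (metis (no_types, lifting) A_def bounded_cball bounded_subset compact_eq_bounded_closed mem_Collect_eq subsetI)
  then obtain b where b: "b \<in> A" "\<And>z. z \<in> A \<Longrightarrow> norm z \<le> norm b"
    using continuous_attains_sup[of A norm] a(1) by (auto simp: A_def intro: continuous_intros)
  have "norm b = 1"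
  proof (rule ccontr)
    assume "norm b \<noteq> 1"
    then have b1: "b \<in> ball 0 1" using b(1) by (auto simp: A_def)
    obtain e where e: "e > 0" "\<And>z. z \<in> ball b e \<Longrightarrow> u z = u b"
      using sum_norm_powr_locally_constant_at_max[of I "ball 0 1" b p f] assms(1,2) hol b b1 a
      unfolding u_def A_def by auto
    \<comment> \<open>A radial step of length \<open>d\<close>: \<open>e/2\<close> keeps it inside
      the ball of constancy, \<open>1 - norm b\<close> inside the closed disc. At
      \<open>b = 0\<close> every direction is outward and 1 is chosen.\<close>
    define d where "d = min (e/2) (1 - norm b)"
    define z where "z = b + of_real d * (if b = 0 then 1 else sgn b)"
    have d: "0 < d" "d < e" "d \<le> 1 - norm b" using e b1 by (auto simp: d_def)
    have "norm z = norm b + d"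
    proof (cases "b = 0")
      case False
      then have "z = of_real (1 + d / norm b) * b"
        by (simp add: z_def sgn_div_norm scaleR_conv_of_real ring_distribs divide_inverse)
      then have "norm z = \<bar>1 + d / norm b\<bar> * norm b"
        by (simp only: norm_mult norm_of_real)
      then show ?thesis using False d(1) by (simp add: ring_distribs)
    qed (use d in \<open>simp add: z_def\<close>)
    moreover have "dist b z < e" using d by (auto simp: z_def dist_norm norm_mult norm_sgn)
    ultimately have "z \<in> A" using e(2)[of z] b(1) d by (auto simp: A_def)
    then show False using b(2)[of z] \<open>norm z = norm b + d\<close> d by simp
  qed
  then show ?thesis
    using a(2)[OF assms(3)] b(1) by (intro bexI[of _ b]) (auto simp: A_def u_def)
qed

section \<open>Riemann sums and rotation invariance of integrals over the circle\<close>

text \<open>Each cell of length \<open>1 / n\<close> contributes an error of at most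
  \<open>e / n\<close>.\<close>

lemma left_Riemann_sum_error:
  fixes h :: "real \<Rightarrow> real" and n :: nat
  assumes cont: "continuous_on {0..1} h" and "0 < n"
    and osc: "\<And>k t. k < n \<Longrightarrow> t \<in> {real k / real n..real (Suc k) / real n} \<Longrightarrow> \<bar>h t - h (real k / real n)\<bar> \<le> e"
  shows "\<bar>integral {0..1} h - (\<Sum>k<n. h (real k / real n)) / real n\<bar> \<le> e"
proof -
  define x where "x k = real k / real n" for k
  have x_Suc: "x (Suc m) = x m + 1 / n" for m by (simp add: x_def add_divide_distrib)
  have int: "h integrable_on {a..b}" if "0 \<le> a" "b \<le> 1" for a b
    using that by (intro integrable_continuous_interval continuous_on_subset[OF cont]) auto
  have e0: "0 \<le> e" using osc[of 0 0] \<open>0 < n\<close> by auto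
  \<comment> \<open>The error is measured against the length \<open>x m\<close> covered so far,
    which makes the bound additive and suited to induction on the number of cells.\<close>
  have "\<bar>integral {0..x m} h - (\<Sum>k<m. h (x k)) / n\<bar> \<le> e * x m" if "m \<le> n" for m
    using that
  proof (induction m)
    case 0
    then show ?case by (simp add: x_def)
  next
    case (Suc m)
    have le: "x (Suc m) \<le> 1" "0 \<le> x m" "x m \<le> x (Suc m)"
      using Suc.prems \<open>0 < n\<close> by (auto simp: x_def divide_simps)
    have inth: "h integrable_on {x m..x (Suc m)}" by (rule int[OF le(2,1)])
    have width: "measure lborel {x m..x (Suc m)} = 1 / n"
      using le(3) by (simp only: measure_lborel_Icc) (simp add: x_Suc)
    have "((\<lambda>t. h t - h (x m)) has_integral (integral {x m..x (Suc m)} h - measure lborel {x m..x (Suc m)} *\<^sub>R h (x m)))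
        {x m..x (Suc m)}"
      by (rule has_integral_diff[OF integrable_integral[OF inth] has_integral_const_real])
    then have "norm (integral {x m..x (Suc m)} h - measure lborel {x m..x (Suc m)} *\<^sub>R h (x m))
        \<le> e * measure lborel {x m..x (Suc m)}"
      by (rule has_integral_bound_real[OF e0 finite.emptyI]) (use osc[of m] Suc.prems in \<open>auto simp: x_def\<close>)
    then have "\<bar>integral {x m..x (Suc m)} h - h (x m) / n\<bar> \<le> e / n"
      unfolding width by simp
    moreover have "integral {0..x (Suc m)} h = integral {0..x m} h + integral {x m..x (Suc m)} h"
      by (rule Henstock_Kurzweil_Integration.integral_combine[symmetric, OF le(2,3) int[OF order_refl le(1)]])
    moreover have "\<bar>integral {0..x m} h - (\<Sum>k<m. h (x k)) / n\<bar> \<le> e * x m" using Suc by simp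
    moreover have "(\<Sum>k<Suc m. h (x k)) / n = (\<Sum>k<m. h (x k)) / n + h (x m) / n"
      by (simp add: add_divide_distrib)
    moreover have "e * x (Suc m) = e * x m + e / n" by (simp add: x_Suc ring_distribs)
    ultimately show ?case by linarith
  qed
  from this[of n] show ?thesis using \<open>0 < n\<close> by (simp add: x_def)
qed

text \<open>Writing \<open>c = cis (2*pi*s)\<close> turns the rotation into a shift of a 1-periodic
  integrand by \<open>s\<close>; the part sticking out beyond 1 is moved back to the beginning by
  periodicity.\<close>

lemma integral_cis_rotate:
  fixes F :: "complex \<Rightarrow> real"
  assumes cont: "continuous_on (sphere 0 1) F" and "norm c = 1"
  shows "integral {0..1} (\<lambda>t. F (c * cis (2*pi*t))) = integral {0..1} (\<lambda>t. F (cis (2*pi*t)))"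
proof -
  define s where "s = Arg2pi c / (2*pi)"
  have s: "0 \<le> s" "s \<le> 1" "c = cis (2*pi * s)"
    using Arg2pi[of c] \<open>norm c = 1\<close> by (auto simp: s_def cis_conv_exp is_Arg_def)
  define h where "h t = F (cis (2*pi*t))" for t
  have ch: "continuous_on A h" for A
    unfolding h_def by (intro continuous_on_compose2[OF cont] continuous_intros) auto
  have per: "h (t + 1) = h t" for t
    by (simp add: h_def ring_distribs flip: cis_mult)
  have "integral {0..1} (\<lambda>t. F (c * cis (2*pi*t))) = integral {0..1} (h \<circ> (\<lambda>t. t + s))"
    by (simp add: h_def s(3) cis_mult ring_distribs add_ac o_def)
  also have "\<dots> = integral {s..1+s} h"
    using integral_shift[of 0 s 1 h] ch by simp
  also have "\<dots> = integral {s..1} h + integral {1..1+s} h"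
    using s Henstock_Kurzweil_Integration.integral_combine[of s 1 "1+s" h] integrable_continuous_interval[OF ch] by simp
  also have "integral {1..1+s} h = integral {0..s} (h \<circ> (\<lambda>t. t + 1))"
    using integral_shift[of 0 1 s h] ch by (simp add: add_ac)
  also have "\<dots> = integral {0..s} h" by (simp add: o_def per)
  also have "integral {s..1} h + integral {0..s} h = integral {0..1} h"
    using Henstock_Kurzweil_Integration.integral_combine[of 0 s 1 h] s integrable_continuous_interval[OF ch] by simp
  finally show ?thesis unfolding h_def .
qed

lemma dist_cis_le: "dist (cis a) (cis b) \<le> \<bar>a - b\<bar>"
proof -
  have "cis a - cis b = cis b * (cis (a - b) - 1)" by (simp add: algebra_simps cis_mult)
  then have "dist (cis a) (cis b) = 2 * \<bar>sin ((a - b) / 2)\<bar>"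
    using dist_exp_i_1[of "a - b"] by (simp add: dist_norm norm_mult cis_conv_exp)
  then show ?thesis using abs_sin_x_le_abs_x[of "(a - b) / 2"] by simp
qed

text \<open>The maximum principle is applied to the Riemann sums of the mean, regarded as
  functions of the starting point \<open>w\<close>; they converge uniformly on the closed disc.\<close>

lemma circle_mean_le_boundary:
  assumes "0 < p" and hol: "f holomorphic_on ball 0 1" and cont: "continuous_on (cball 0 1) f"
    and r: "0 \<le> r" "r \<le> 1"
  shows "circle_mean p f r \<le> circle_mean p f 1"
proof (rule field_le_epsilon)
  fix e :: real assume "e > 0"
  define F where "F z = norm (f z) powr p" for z
  have cF: "continuous_on (cball 0 1) F"
    unfolding F_def using cont \<open>0 < p\<close> by (intro continuous_intros continuous_on_powr') auto
  then have "uniformly_continuous_on (cball 0 1) F" by (simp add: compact_uniformly_continuous)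
  then obtain d where d: "d > 0"
      "\<And>x y. x \<in> cball 0 1 \<Longrightarrow> y \<in> cball 0 1 \<Longrightarrow> dist y x < d \<Longrightarrow> dist (F y) (F x) < e/2"
    using \<open>e > 0\<close> unfolding uniformly_continuous_on_def by (metis half_gt_zero)
  \<comment> \<open>This makes the spacing \<open>2*pi/n\<close> of the nodes smaller than
    \<open>d\<close>. As \<open>norm w \<le> 1\<close>, multiplication by \<open>w\<close> does not
    enlarge it, so one \<open>n\<close> serves all starting points \<open>w\<close>.\<close>
  obtain n :: nat where n: "n > 2 * pi / d" by (meson reals_Archimedean2)
  have "0 < 2 * pi / d" using d by simp
  then have n0: "n > 0" using n by (metis gr0I less_asym of_nat_0)
  have Riem: "\<bar>integral {0..1} (\<lambda>t. F (w * cis (2*pi*t))) - (\<Sum>k<n. F (w * cis (2*pi*(k/n)))) / n\<bar> \<le> e/2"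
    if w: "norm w \<le> 1" for w
  proof (rule left_Riemann_sum_error[of "\<lambda>t. F (w * cis (2*pi*t))"])
    show "continuous_on {0..1} (\<lambda>t. F (w * cis (2*pi*t)))"
      by (intro continuous_on_compose2[OF cF] continuous_intros) (use w in \<open>auto simp: norm_mult\<close>)
    fix k t assume k: "k < n" and t: "t \<in> {real k / real n..real (Suc k) / real n}"
    have "dist (w * cis (2*pi*t)) (w * cis (2*pi*(k/n))) = norm w * dist (cis (2*pi*t)) (cis (2*pi*(k/n)))"
      by (simp add: dist_norm norm_mult flip: right_diff_distrib)
    also have "\<dots> \<le> 1 * \<bar>2*pi*t - 2*pi*(k/n)\<bar>"
      using w by (intro mult_mono dist_cis_le) auto
    also have "\<dots> = \<bar>2 * pi * (t - k/n)\<bar>" by (simp only: right_diff_distrib mult_1)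
    also have "\<dots> = 2 * pi * (t - k/n)" using t by (simp add: abs_mult)
    also have "\<dots> \<le> 2 * pi * (1/n)"
      using t by (intro mult_left_mono) (auto simp: add_divide_distrib)
    also have "\<dots> < d" using n n0 d by (simp add: field_simps)
    finally show "\<bar>F (w * cis (2*pi*t)) - F (w * cis (2*pi*(k/n)))\<bar> \<le> e/2"
      using d(2)[of "w * cis (2*pi*(k/n))" "w * cis (2*pi*t)"] w
      by (simp add: norm_mult dist_real_def)
  qed (rule n0)
  have "\<exists>z\<in>sphere 0 1. (\<Sum>k<n. F (of_real r * cis (2*pi*(k/n)))) \<le> (\<Sum>k<n. F (z * cis (2*pi*(k/n))))"
    unfolding F_def
  proof (rule sum_norm_powr_max_principle)
    fix k :: nat
    have *: "(\<lambda>w. w * cis (2*pi*(k/n))) ` ball 0 1 \<subseteq> ball 0 1" by (auto simp: norm_mult)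
    show "(\<lambda>w. f (w * cis (2*pi*(k/n)))) holomorphic_on ball 0 1"
      by (rule holomorphic_on_compose_gen[OF _ hol *, unfolded o_def]) (intro holomorphic_intros)
    show "continuous_on (cball 0 1) (\<lambda>w. f (w * cis (2*pi*(k/n))))"
      by (intro continuous_on_compose2[OF cont] continuous_intros) (auto simp: norm_mult)
  qed (use r \<open>0 < p\<close> in auto)
  then obtain z where z: "norm z = 1"
    "(\<Sum>k<n. F (of_real r * cis (2*pi*(k/n)))) / n \<le> (\<Sum>k<n. F (z * cis (2*pi*(k/n)))) / n"
    using divide_right_mono by fastforce
  \<comment> \<open>Each of the two Riemann sums, at \<open>r\<close> and at \<open>z\<close>, costs
    \<open>e/2\<close>; the rotation by \<open>z\<close> is then undone.\<close>
  have "integral {0..1} (\<lambda>t. F (of_real r * cis (2*pi*t))) \<le> integral {0..1} (\<lambda>t. F (z * cis (2*pi*t))) + e"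
  proof -
    have "norm (of_real r :: complex) \<le> 1" "norm z \<le> 1" using r z by auto
    from this[THEN Riem] z(2) show ?thesis unfolding abs_le_iff by linarith
  qed
  also have "integral {0..1} (\<lambda>t. F (z * cis (2*pi*t))) = integral {0..1} (\<lambda>t. F (cis (2*pi*t)))"
    using continuous_on_subset[OF cF] z by (intro integral_cis_rotate) auto
  finally show "circle_mean p f r \<le> circle_mean p f 1 + e"
    by (simp add: circle_mean_def F_def)
qed

section \<open>Density of continuous functions\<close>

text \<open>On the circle \<open>cnj z\<close> is \<open>1 / z\<close>, so in
  \<open>2 * Re A * Re B = Re (A * B) + Re (A * cnj B)\<close> the second product is again a
  monomial, of degree \<open>j - k\<close> if \<open>k \<le> j\<close>; the other case follows by
  symmetry. This makes real parts of polynomials on the circle closed under products.\<close>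

lemma Re_monom_mult_on_circle:
  fixes a b :: complex
  shows "\<exists>P. \<forall>z\<in>sphere 0 1. Re (a * z ^ j) * Re (b * z ^ k) = Re (poly P z)"
proof -
  have *: "\<exists>P. \<forall>z\<in>sphere 0 1. Re (a * z ^ j) * Re (b * z ^ k) = Re (poly P z)" if "k \<le> j" for a b :: complex and j k
  proof (intro exI ballI)
    fix z :: complex assume "z \<in> sphere 0 1"
    then have "z * cnj z = 1" by (simp add: complex_norm_square[symmetric])
    then have "z ^ k * cnj z ^ k = 1" by (simp flip: power_mult_distrib)
    moreover have "z ^ j = z ^ (j - k) * z ^ k" using that by (simp flip: power_add)
    ultimately have *: "z ^ j * cnj z ^ k = z ^ (j - k)" by (simp only: mult.assoc mult_1_right)
    define A B where "A = a * z ^ j" and "B = b * z ^ k"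
    have "A * cnj B = a * cnj b * (z ^ j * cnj z ^ k)" by (simp add: A_def B_def)
    moreover have "A * B = a * b * z ^ (j + k)" by (simp add: A_def B_def power_add)
    ultimately have "poly (monom (a * b / 2) (j + k) + monom (a * cnj b / 2) (j - k)) z = (A * B + A * cnj B) / 2"
      by (simp add: poly_monom add_divide_distrib *)
    then have "Re A * Re B = Re (poly (monom (a * b / 2) (j + k) + monom (a * cnj b / 2) (j - k)) z)"
      by (simp only:) simp
    then show "Re (a * z ^ j) * Re (b * z ^ k)
        = Re (poly (monom (a * b / 2) (j + k) + monom (a * cnj b / 2) (j - k)) z)"
      by (simp only: A_def B_def)
  qed
  show ?thesis
  proof (cases "k \<le> j")
    case False
    then show ?thesis using *[of j k b a] by (simp add: mult.commute)
  qed (rule *)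
qed

text \<open>Stone-Weierstrass for the algebra of real parts of polynomials: it contains the
  constants, and \<open>Re\<close> and \<open>Im\<close> separate points.\<close>

lemma Re_poly_dense_on_circle:
  fixes g :: "complex \<Rightarrow> real"
  assumes "continuous_on (sphere 0 1) g" "0 < e"
  obtains P where "\<And>z. z \<in> sphere 0 1 \<Longrightarrow> \<bar>g z - Re (poly P z)\<bar> < e"
proof -
  define R where "R u \<longleftrightarrow> (\<exists>P. \<forall>z\<in>sphere 0 1. u z = Re (poly P z))" for u :: "complex \<Rightarrow> real"
  have add: "R (\<lambda>z. u z + v z)" if "R u" "R v" for u v
    using that unfolding R_def by (metis plus_complex.simps(1) poly_add)
  have sum: "R (\<lambda>z. \<Sum>i\<in>I. u i z)" if "finite I" "\<And>i. i \<in> I \<Longrightarrow> R (u i)" for I :: "'i set" and u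
    using that by (induction I) (auto intro: add simp: R_def[of "\<lambda>_. 0"] intro: exI[of _ 0])
  have mult: "R (\<lambda>z. u z * v z)" if "R u" "R v" for u v
  proof -
    obtain P Q where PQ: "\<forall>z\<in>sphere 0 1. u z = Re (poly P z)" "\<forall>z\<in>sphere 0 1. v z = Re (poly Q z)"
      using \<open>R u\<close> \<open>R v\<close> unfolding R_def by auto
    have "R (\<lambda>z. \<Sum>i\<le>degree P. \<Sum>j\<le>degree Q. Re (coeff P i * z ^ i) * Re (coeff Q j * z ^ j))"
      by (intro sum finite_atMost) (simp only: R_def Re_monom_mult_on_circle)
    then show ?thesis
      using PQ by (simp add: R_def poly_altdef sum_product)
  qed
  have "\<exists>u. R u \<and> (\<forall>z\<in>sphere 0 1. \<bar>g z - u z\<bar> < e)"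
  proof (rule Stone_Weierstrass_HOL[OF compact_sphere])
    show "R (\<lambda>z. c)" for c
      unfolding R_def by (rule exI[of _ "[:of_real c:]"]) simp
    show "continuous_on (sphere 0 1) u" if "R u" for u
      using that unfolding R_def
      by (metis (no_types, lifting) continuous_on_Re continuous_on_cong continuous_on_poly continuous_on_id)
    show "\<exists>u. R u \<and> u x \<noteq> u y" if "x \<in> sphere 0 1 \<and> y \<in> sphere 0 1 \<and> x \<noteq> y" for x y
    proof -
      have "R Re" unfolding R_def by (rule exI[of _ "[:0, 1:]"]) simp
      moreover have "R Im" unfolding R_def by (rule exI[of _ "[:0, -\<i>:]"]) simp
      ultimately show ?thesis using that complex_eq_iff by blast
    qed
  qed (use assms add mult in auto)
  then show thesis unfolding R_def using that by metis
qed

section \<open>Continuous approximation with respect to finite Borel measures\<close>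

text \<open>Regularity gives a compact \<open>K\<close> inside and an open \<open>U\<close> around
  \<open>A\<close> with \<open>U - K\<close> of measure below \<open>e\<close>; a Urysohn function
  for \<open>K\<close> and \<open>- U\<close> differs from the indicator at most on
  \<open>U - K\<close>.\<close>

lemma continuous_approx_indicator:
  fixes A :: "'a::euclidean_space set"
  assumes "finite_measure M" and sb: "sets M = sets borel" and A: "A \<in> sets borel" and "0 < e"
  shows "\<exists>g::'a \<Rightarrow> real. continuous_on UNIV g \<and> (\<forall>x. g x \<in> {0..1}) \<and>
    (\<integral>x. \<bar>indicator A x - g x\<bar> \<partial>M) < e"
proof -
  interpret finite_measure M by fact
  have space: "space M = UNIV" using sb sets_eq_imp_space_eq by fastforce
  have fin: "emeasure M (space M) \<noteq> \<infinity>" by simp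
  \<comment> \<open>The null case is separate because \<open>ennreal\<close> sends the negative
    number \<open>- e/2\<close> to 0, so the strict inequality used with inner regularity would
    fail.\<close>
  obtain K where K: "K \<subseteq> A" "compact K" "measure M K > measure M A - e/2"
  proof (cases "measure M A = 0")
    case True
    then show ?thesis using that[of "{}"] \<open>0 < e\<close> by simp
  next
    case False
    have "ennreal (measure M A - e/2) < emeasure M A"
      using False \<open>0 < e\<close> by (simp add: emeasure_eq_measure ennreal_less_iff less_eq_real_def
          zero_less_measure_iff ennreal_lessI)
    then obtain K where "K \<subseteq> A" "compact K" "ennreal (measure M A - e/2) < emeasure M K"
      using inner_regular[OF sb fin A] by (auto simp: less_SUP_iff)
    moreover from this have "\<not> measure M K \<le> measure M A - e/2"
      using ennreal_leI[of "measure M K"] by (auto simp: emeasure_eq_measure not_le[symmetric])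
    ultimately show ?thesis using that[of K] by simp
  qed
  obtain U where U: "A \<subseteq> U" "open U" "measure M U < measure M A + e/2"
  proof -
    have "emeasure M A < ennreal (measure M A + e/2)"
      using \<open>0 < e\<close> by (simp add: emeasure_eq_measure ennreal_less_iff)
    then obtain U where "A \<subseteq> U" "open U" "emeasure M U < ennreal (measure M A + e/2)"
      using outer_regular[OF sb fin A] by (auto simp: INF_less_iff)
    then show ?thesis
      using that[of U] by (auto simp: emeasure_eq_measure ennreal_less_iff)
  qed
  obtain g :: "'a \<Rightarrow> real" where g: "continuous_on UNIV g" "\<And>x. g x \<in> closed_segment 1 0"
      "\<And>x. x \<in> K \<Longrightarrow> g x = 1" "\<And>x. x \<in> - U \<Longrightarrow> g x = 0"
    by (rule Urysohn[of K "- U" 1 "0::real"]) (use K U compact_imp_closed in auto)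
  have g01: "g x \<in> {0..1}" for x
    using g(2)[of x] by (simp add: closed_segment_eq_real_ivl)
  have meas: "K \<in> sets M" "U \<in> sets M" "A \<in> sets M"
    using K U A sb by (auto simp: borel_compact)
  have "(\<integral>x. \<bar>indicator A x - g x\<bar> \<partial>M) \<le> (\<integral>x. indicator (U - K) x \<partial>M)"
  proof (rule integral_mono')
    show "integrable M (indicator (U - K) :: _ \<Rightarrow> real)" using meas by (auto simp: emeasure_eq_measure)
    show "\<bar>indicator A x - g x\<bar> \<le> indicator (U - K) x" for x
      using g01[of x] g(3,4)[of x] K(1) U(1) by (auto simp: indicator_def split: if_splits)
  qed auto
  also have "\<dots> = measure M U - measure M K"
    using meas K U space by (simp add: finite_measure_Diff)
  also have "\<dots> < e" using K U by linarith
  finally show ?thesis using g g01 by auto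
qed

text \<open>Induction along the construction of integrable functions: multiples of indicators, sums,
  dominated limits.\<close>

lemma continuous_dense_L1:
  fixes u :: "'a::euclidean_space \<Rightarrow> real"
  assumes "finite_measure M" and sb: "sets M = sets borel" and "integrable M u" and "0 < e"
  shows "\<exists>g. continuous_on UNIV g \<and> integrable M g \<and> (\<integral>x. \<bar>u x - g x\<bar> \<partial>M) < e"
  using assms(3,4)
proof (induction u arbitrary: e rule: integrable_induct)
  case (base A c)
  interpret finite_measure M by fact
  \<comment> \<open>Dividing by \<open>\<bar>c\<bar> + 1\<close> instead of
    \<open>\<bar>c\<bar>\<close> also covers \<open>c = 0\<close>.\<close>
  have "0 < e / (\<bar>c\<bar> + 1)" using base by simp
  then obtain g where g: "continuous_on UNIV g" "\<And>x. g x \<in> {0..1}"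
      "(\<integral>x. \<bar>indicator A x - g x\<bar> \<partial>M) < e / (\<bar>c\<bar> + 1)"
    using continuous_approx_indicator[OF \<open>finite_measure M\<close> sb, of A] base sb by metis
  have [measurable]: "g \<in> borel_measurable M"
    using g(1) borel_measurable_continuous_onI measurable_cong_sets[OF sb refl] by blast
  have "integrable M g"
    by (rule integrable_const_bound[where B = 1]) (use g(2) in \<open>auto simp: abs_le_iff intro: order_trans\<close>)
  moreover have "(\<integral>x. \<bar>indicator A x *\<^sub>R c - c * g x\<bar> \<partial>M) = \<bar>c\<bar> * (\<integral>x. \<bar>indicator A x - g x\<bar> \<partial>M)"
    by (simp add: abs_mult mult.commute flip: right_diff_distrib left_diff_distrib integral_mult_right_zero)
  moreover have "\<dots> < e"
  proof -
    have "\<bar>c\<bar> * (\<integral>x. \<bar>indicator A x - g x\<bar> \<partial>M) \<le> \<bar>c\<bar> * (e / (\<bar>c\<bar> + 1))"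
      using g(3) by (intro mult_left_mono) auto
    also have "\<dots> < e" using base by (simp add: field_simps)
    finally show ?thesis .
  qed
  ultimately show ?case
    using g(1) by (intro exI[of _ "\<lambda>x. c * g x"]) (auto intro!: continuous_intros)
next
  case (add u v)
  obtain g h where *: "continuous_on UNIV g" "integrable M g" "(\<integral>x. \<bar>u x - g x\<bar> \<partial>M) < e/2"
      "continuous_on UNIV h" "integrable M h" "(\<integral>x. \<bar>v x - h x\<bar> \<partial>M) < e/2"
    using add.IH[of "e/2"] add.prems by (metis half_gt_zero)
  have "(\<integral>x. \<bar>u x + v x - (g x + h x)\<bar> \<partial>M) \<le> (\<integral>x. \<bar>u x - g x\<bar> + \<bar>v x - h x\<bar> \<partial>M)"
    using add * by (intro integral_mono) auto
  also have "\<dots> < e" using add * by (subst Bochner_Integration.integral_add) auto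
  finally show ?case
    using * by (intro exI[of _ "\<lambda>x. g x + h x"]) (auto intro!: continuous_intros)
next
  case (lim u s)
  have "(\<lambda>i. \<integral>x. \<bar>u x - s i x\<bar> \<partial>M) \<longlonglongrightarrow> (\<integral>x. 0 \<partial>M)"
  \<comment> \<open>The induction rule supplies
    \<open>\<bar>s i x\<bar> \<le> 2 * \<bar>u x\<bar>\<close>, hence the factor 3.\<close>
  proof (rule integral_dominated_convergence[where w = "\<lambda>x. 3 * \<bar>u x\<bar>"])
    show "AE x in M. (\<lambda>i. \<bar>u x - s i x\<bar>) \<longlonglongrightarrow> 0"
    proof (rule AE_I2)
      fix x assume "x \<in> space M"
      from tendsto_rabs[OF tendsto_diff[OF tendsto_const[of "u x"] lim.hyps(2)[OF this]]]
      show "(\<lambda>i. \<bar>u x - s i x\<bar>) \<longlonglongrightarrow> 0" by simp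
    qed
    show "AE x in M. norm \<bar>u x - s i x\<bar> \<le> 3 * \<bar>u x\<bar>" for i
    proof (rule AE_I2)
      fix x assume "x \<in> space M"
      then show "norm \<bar>u x - s i x\<bar> \<le> 3 * \<bar>u x\<bar>" using lim.hyps(3)[of x i] by simp
    qed
  qed (use lim in auto)
  then obtain i where i: "(\<integral>x. \<bar>u x - s i x\<bar> \<partial>M) < e/2"
    using order_tendstoD(2)[of _ "\<integral>x. 0 \<partial>M" sequentially "e/2"] lim.prems
    by (fastforce simp: eventually_sequentially)
  obtain g where g: "continuous_on UNIV g" "integrable M g" "(\<integral>x. \<bar>s i x - g x\<bar> \<partial>M) < e/2"
    using lim.IH[of "e/2" i] lim.prems by auto
  have "(\<integral>x. \<bar>u x - g x\<bar> \<partial>M) \<le> (\<integral>x. \<bar>u x - s i x\<bar> + \<bar>s i x - g x\<bar> \<partial>M)"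
    using lim g by (intro integral_mono) auto
  also have "\<dots> < e" using lim g i by (subst Bochner_Integration.integral_add) auto
  finally show ?case using g by auto
qed

text \<open>Continuous functions converging in L1 have a subsequence converging almost everywhere;
  clipping it to \<open>{0..B}\<close> preserves continuity and, since \<open>u\<close> has its
  values there, the limit.\<close>

lemma bounded_borel_AE_limit_continuous:
  fixes u :: "'a::euclidean_space \<Rightarrow> real"
  assumes "finite_measure M" and sb: "sets M = sets borel" and [measurable]: "u \<in> borel_measurable borel"
    and u: "\<And>x. 0 \<le> u x" "\<And>x. u x \<le> B"
  shows "\<exists>g. (\<forall>n. continuous_on UNIV (g n)) \<and> (\<forall>n x. g n x \<in> {0..B}) \<and>
    (AE x in M. (\<lambda>n. g n x) \<longlonglongrightarrow> u x)"
proof -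
  interpret finite_measure M by fact
  have "u \<in> borel_measurable M" by (simp add: measurable_cong_sets[OF sb refl])
  then have int: "integrable M u"
    by (rule integrable_const_bound[where B = B, rotated]) (use u in auto)
  have "\<exists>g. continuous_on UNIV g \<and> integrable M g \<and> (\<integral>x. \<bar>u x - g x\<bar> \<partial>M) < 1 / real (Suc n)" for n
    by (rule continuous_dense_L1) (use int sb \<open>finite_measure M\<close> in auto)
  then obtain g where g: "\<And>n. continuous_on UNIV (g n)" "\<And>n. integrable M (g n)"
      "\<And>n. (\<integral>x. \<bar>u x - g n x\<bar> \<partial>M) < 1 / real (Suc n)"
    by metis
  have "(\<lambda>n. \<integral>x. norm (u x - g n x) \<partial>M) \<longlonglongrightarrow> 0"
  proof (rule tendsto_sandwich[OF _ _ tendsto_const LIMSEQ_inverse_real_of_nat])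
    show "\<forall>\<^sub>F n in sequentially. (\<integral>x. norm (u x - g n x) \<partial>M) \<le> inverse (real (Suc n))"
      using g(3) by (auto simp: inverse_eq_divide less_imp_le intro!: always_eventually)
  qed simp
  then obtain r where "AE x in M. (\<lambda>n. u x - g (r n) x) \<longlonglongrightarrow> 0"
    using tendsto_L1_AE_subseq[of M "\<lambda>n x. u x - g n x"] int g(2) by auto
  then have "AE x in M. (\<lambda>n. max 0 (min B (g (r n) x))) \<longlonglongrightarrow> u x"
  proof eventually_elim
    case (elim x)
    have "(\<lambda>n. u x - (u x - g (r n) x)) \<longlonglongrightarrow> u x - 0"
      by (intro tendsto_intros elim)
    then have "(\<lambda>n. max 0 (min B (g (r n) x))) \<longlonglongrightarrow> max 0 (min B (u x))"
      by (intro tendsto_intros) simp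
    then show ?case using u[of x] by simp
  qed
  moreover have "0 \<le> B" using u[of undefined] by linarith
  ultimately show ?thesis
    using g(1) by (intro exI[of _ "\<lambda>n x. max 0 (min B (g (r n) x))"]) (auto intro!: continuous_intros)
qed

text \<open>Serves to have one sequence converge almost everywhere for two measures at once, even
  mutually singular ones. The supremum of the two measures does it, being bounded by their
  sum.\<close>

lemma ex_finite_measure_dominating:
  assumes "finite_measure M" "finite_measure N" "sets M = sets N"
  obtains L where "finite_measure L" "sets L = sets N"
    "absolutely_continuous L M" "absolutely_continuous L N"
proof
  let ?L = "sup_measure' M N"
  have sp: "space M = space N" using assms(3) by (rule sets_eq_imp_space_eq)
  interpret M: finite_measure M by fact
  interpret N: finite_measure N by fact
  show "finite_measure ?L"
  proof (rule finite_measureI)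
    have "emeasure ?L (space ?L) \<le> emeasure M (space M) + emeasure N (space N)"
      using assms(3) sp by (subst emeasure_sup_measure') (auto intro!: SUP_least add_mono emeasure_mono dest: sets.sets_into_space simp: sp)
    then show "emeasure ?L (space ?L) \<noteq> \<infinity>"
      by (auto simp: M.emeasure_eq_measure N.emeasure_eq_measure top_unique simp flip: ennreal_plus)
  qed
  show "sets ?L = sets N" using assms(3) by simp
  show "absolutely_continuous ?L M" "absolutely_continuous ?L N"
    using le_emeasure_sup_measure'1[of N M] le_emeasure_sup_measure'2[of N M] assms(3)
    by (auto simp: absolutely_continuous_def null_sets_def) (metis le_zero_eq)+
qed

section \<open>Hardy and Lebesgue norms as integrals\<close>

lemma sets_circle_measure [simp, measurable_cong]: "sets circle_measure = sets borel"
  by (simp add: circle_measure_def)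

lemma space_circle_measure [simp]: "space circle_measure = UNIV"
  by (simp add: circle_measure_def)

lemma measurable_cis_unit_interval:
  "(\<lambda>t. cis (2 * pi * t)) \<in> restrict_space lborel {0::real..1} \<rightarrow>\<^sub>M borel"
proof -
  have "(\<lambda>t::real. cis (2 * pi * t)) \<in> borel_measurable borel"
    by (intro borel_measurable_continuous_onI continuous_intros)
  then show ?thesis by (simp add: measurable_restrict_space1)
qed

lemma finite_measure_circle_measure: "finite_measure circle_measure"
proof (rule finite_measureI)
  have "emeasure circle_measure (space circle_measure) = emeasure (restrict_space lborel {0::real..1}) {0..1}"
    unfolding circle_measure_def
    by (subst emeasure_distr[OF measurable_cis_unit_interval]) (auto simp: space_restrict_space)
  also have "\<dots> = 1" by (simp add: emeasure_restrict_space)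
  finally show "emeasure circle_measure (space circle_measure) \<noteq> \<infinity>" by simp
qed

lemma AE_circle_measure_sphere: "AE z in circle_measure. z \<in> sphere 0 1"
  unfolding circle_measure_def
  by (subst AE_distr_iff[OF measurable_cis_unit_interval]) (auto simp: pred_def[symmetric])

lemma integral_circle_measure:
  fixes F :: "complex \<Rightarrow> real"
  assumes "continuous_on (sphere 0 1) F" "F \<in> borel_measurable borel"
  shows "(\<integral>z. F z \<partial>circle_measure) = integral {0..1} (\<lambda>t. F (cis (2 * pi * t)))"
proof -
  have "continuous_on {0..1} (\<lambda>t. F (cis (2 * pi * t)))"
    by (intro continuous_on_compose2[OF assms(1)] continuous_intros) auto
  then have "(LINT t : {0..1} | lborel. F (cis (2 * pi * t))) = integral {0..1} (\<lambda>t. F (cis (2 * pi * t)))"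
    by (intro set_borel_integral_eq_integral borel_integrable_atLeastAtMost')
  then show ?thesis
    unfolding circle_measure_def set_lebesgue_integral_def
    by (subst integral_distr[OF measurable_cis_unit_interval assms(2)], subst integral_restrict_space) auto
qed

lemma continuous_on_circle_mean:
  assumes "0 < p" "continuous_on (cball 0 1) f"
  shows "continuous_on {0..1} (circle_mean p f)"
proof -
  have "continuous_on ({0..1} \<times> cbox 0 1) (\<lambda>(r, t). norm (f (of_real r * cis (2 * pi * t))) powr p)"
    unfolding case_prod_beta
    by (intro continuous_on_powr' continuous_on_norm continuous_on_compose2[OF assms(2)] continuous_intros)
      (use assms in \<open>auto simp: norm_mult\<close>)
  from integral_continuous_on_param[OF this] show ?thesis
    unfolding circle_mean_def by simp
qed

text \<open>The means are at most the mean on the circle and tend to it as \<open>r\<close>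
  approaches 1, so it is their supremum.\<close>

lemma
  assumes "0 < p" "f holomorphic_on ball 0 1" "continuous_on (cball 0 1) f"
  shows in_hardy_if_continuous: "f \<in> hardy p"
    and hardy_norm_eq_circle_mean: "hardy_norm p f = circle_mean p f 1 powr (1 / p)"
proof -
  have le: "circle_mean p f r \<le> circle_mean p f 1" if "r \<in> {0<..<1}" for r
    using circle_mean_le_boundary[OF assms] that by simp
  then have bdd: "bdd_above (circle_mean p f ` {0<..<1})" by (intro bdd_aboveI2)
  then show "f \<in> hardy p" using assms by (simp add: hardy_def)
  have "(circle_mean p f \<longlongrightarrow> circle_mean p f 1) (at 1 within {0..1})"
    using continuous_on_circle_mean[OF assms(1,3)] by (auto simp: continuous_on_def)
  then have lim: "(circle_mean p f \<longlongrightarrow> circle_mean p f 1) (at_left 1)"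
    by (simp add: at_within_Icc_at_left)
  have ev: "\<forall>\<^sub>F r in at_left 1. circle_mean p f r \<le> (SUP r\<in>{0<..<1}. circle_mean p f r)"
    using eventually_at_left_real[OF zero_less_one] by eventually_elim (rule cSUP_upper[OF _ bdd])
  have "circle_mean p f 1 \<le> (SUP r\<in>{0<..<1}. circle_mean p f r)"
    by (rule tendsto_upperbound[OF lim ev]) simp
  moreover have "(SUP r\<in>{0<..<1}. circle_mean p f r) \<le> circle_mean p f 1"
    by (rule cSUP_least) (use le in auto)
  ultimately show "hardy_norm p f = circle_mean p f 1 powr (1 / p)"
    unfolding hardy_norm_def by (metis antisym)
qed

text \<open>\<open>f\<close> is controlled only on \<open>S\<close>; multiplying by the indicator
  yields a function that is Borel on the whole plane.\<close>

lemma borel_measurable_indicator_norm_powr: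
  assumes "0 < p" "continuous_on S f" "S \<in> sets borel"
  shows "(\<lambda>z. indicator S z * norm (f z) powr p :: real) \<in> borel_measurable borel"
  using borel_measurable_continuous_on_indicator[OF assms(3), of "\<lambda>z. norm (f z) powr p"] assms
  by (simp add: continuous_on_powr' continuous_on_norm)

lemma circle_mean_eq_integral:
  assumes "0 < p" "continuous_on (cball 0 1) f"
  shows "circle_mean p f 1 = (\<integral>z. indicator (cball 0 1) z * norm (f z) powr p \<partial>circle_measure)"
proof -
  have "continuous_on (sphere 0 1) (\<lambda>z. norm (f z) powr p)"
    by (intro continuous_on_powr' continuous_on_norm continuous_on_subset[OF assms(2)]) (use assms in auto)
  then have "continuous_on (sphere 0 1) (\<lambda>z. indicator (cball 0 1) z * norm (f z) powr p)"
    by (subst continuous_on_cong[OF refl, of _ _ "\<lambda>z. norm (f z) powr p"]) auto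
  from integral_circle_measure[OF this borel_measurable_indicator_norm_powr[OF assms]]
  show ?thesis by (simp add: circle_mean_def)
qed

lemma Lq_norm_eq_integral:
  assumes "0 < q" "continuous_on (cball 0 1) f" "sets \<mu> = sets borel"
  shows "Lq_norm \<mu> q f = (\<integral>z. indicator (cball 0 1) z * norm (f z) powr q \<partial>\<mu>) powr (1 / q)"
proof -
  \<comment> \<open>The default values agree: for an infinite integral \<open>enn2real\<close> and
    the Bochner integral both return 0.\<close>
  have "(\<integral>z. indicator (cball 0 1) z * norm (f z) powr q \<partial>\<mu>)
      = enn2real (\<integral>\<^sup>+z. ennreal (indicator (cball 0 1) z * norm (f z) powr q) \<partial>\<mu>)"
    using borel_measurable_indicator_norm_powr[OF assms(1,2)] assms(3)
    by (intro integral_eq_nn_integral) (auto cong: measurable_cong_sets)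
  also have "(\<integral>\<^sup>+z. ennreal (indicator (cball 0 1) z * norm (f z) powr q) \<partial>\<mu>)
      = (\<integral>\<^sup>+z\<in>cball 0 1. ennreal (norm (f z) powr q) \<partial>\<mu>)"
    by (intro nn_integral_cong) (auto simp: indicator_def)
  finally show ?thesis by (simp add: Lq_norm_def)
qed

section \<open>Sufficiency\<close>

text \<open>On \<open>A - N\<close> the singular term vanishes, and removing the null set
  \<open>N\<close> does not affect the integral of \<open>\<beta>\<close>. The absolutely continuous
  part thus becomes a restriction of \<open>\<nu>\<close>, which lets integrals be moved between the
  two measures.\<close>

lemma ac_part_eq_restriction:
  assumes "is_ac_part_density m \<nu> \<beta>" "sets m = sets borel" "sets \<nu> = sets borel"
  obtains N where "N \<in> sets borel" "emeasure m N = 0"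
    "density m (\<lambda>x. ennreal (\<beta> x)) = density \<nu> (indicator (- N))"
proof -
  have [measurable]: "\<beta> \<in> borel_measurable borel"
    using assms(1) by (simp add: is_ac_part_density_def)
  obtain N where N: "N \<in> sets borel" "emeasure m N = 0"
    and dec: "\<And>A. A \<in> sets borel \<Longrightarrow> emeasure \<nu> A = (\<integral>\<^sup>+ x\<in>A. ennreal (\<beta> x) \<partial>m) + emeasure \<nu> (A \<inter> N)"
    using assms(1) by (auto simp: is_ac_part_density_def)
  have bm: "(\<lambda>x. ennreal (\<beta> x)) \<in> borel_measurable m"
    by (simp add: measurable_cong_sets[OF assms(2) refl])
  have "AE x in m. x \<notin> N" using N assms(2) by (auto intro!: AE_not_in simp: null_sets_def)
  have "density m (\<lambda>x. ennreal (\<beta> x)) = density \<nu> (indicator (- N))"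
  proof (rule measure_eqI)
    fix A assume "A \<in> sets (density m (\<lambda>x. ennreal (\<beta> x)))"
    then have A: "A \<in> sets borel" using assms by simp
    have "emeasure (density m (\<lambda>x. ennreal (\<beta> x))) A = (\<integral>\<^sup>+ x\<in>A. ennreal (\<beta> x) \<partial>m)"
      using A assms bm by (intro emeasure_density) auto
    also have "\<dots> = (\<integral>\<^sup>+ x\<in>A - N. ennreal (\<beta> x) \<partial>m)"
      using \<open>AE x in m. x \<notin> N\<close> by (intro nn_integral_cong_AE) (auto simp: indicator_def)
    also have "\<dots> = emeasure \<nu> (A - N)"
    proof -
      have "(A - N) \<inter> N = {}" by auto
      then show ?thesis using dec[of "A - N"] A N by simp
    qed
    also have "\<dots> = emeasure (density \<nu> (indicator (- N))) A"
      using A N assms by (subst emeasure_restricted) (auto simp: Diff_eq Int_commute)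
    finally show "emeasure (density m (\<lambda>x. ennreal (\<beta> x))) A = emeasure (density \<nu> (indicator (- N))) A" .
  qed (use assms in auto)
  with N show thesis by (rule that)
qed

text \<open>Pointwise substitute for Hoelder's inequality. The powers of \<open>b\<close> cancel
  since \<open>p / (q - p) * (1 - p / q) = p / q\<close>, and
  \<open>X powr \<theta> * Y powr (1 - \<theta>) \<le> X + Y\<close> since both bases are at most
  \<open>X + Y\<close>.\<close>

lemma powr_le_weighted_sum:
  fixes p q b g E :: real
  assumes "0 < p" "p < q" "0 \<le> g" "0 < b" "0 < E"
  shows "g powr p \<le> E powr (p / q) * (g powr q * b / E + (1 / b) powr (p / (q - p)))"
proof -
  define X where "X = g powr q * b / E"
  define Y where "Y = (1 / b) powr (p / (q - p))"
  define \<theta> where "\<theta> = p / q"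
  have \<theta>: "0 < \<theta>" "\<theta> < 1" using assms by (auto simp: \<theta>_def)
  have XY: "0 \<le> X" "0 < Y" using assms by (auto simp: X_def Y_def)
  have "p / (q - p) * (1 - \<theta>) = \<theta>" using assms by (simp add: \<theta>_def field_simps)
  then have "Y powr (1 - \<theta>) = (1 / b) powr \<theta>" by (simp add: Y_def powr_powr)
  moreover have "X powr \<theta> = g powr p * b powr \<theta> / E powr \<theta>"
    using assms by (simp add: X_def powr_mult powr_divide powr_powr \<theta>_def)
  ultimately have "E powr \<theta> * (X powr \<theta> * Y powr (1 - \<theta>)) = g powr p"
    using assms by (simp add: powr_divide)
  moreover have "X powr \<theta> * Y powr (1 - \<theta>) \<le> X + Y"
  proof -
    have "X powr \<theta> * Y powr (1 - \<theta>) \<le> (X + Y) powr \<theta> * (X + Y) powr (1 - \<theta>)"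
      using XY \<theta> by (intro mult_mono powr_mono2) auto
    also have "\<dots> = X + Y" using XY by (simp flip: powr_add)
    finally show ?thesis .
  qed
  ultimately show ?thesis
    using mult_left_mono[of _ "X + Y" "E powr \<theta>"] by (metis X_def Y_def \<theta>_def powr_ge_zero)
qed

text \<open>\<open>\<beta>\<close> times the circle measure is \<open>\<mu>\<close> restricted to
  the circle minus \<open>N\<close>, and restricting lowers integrals of nonnegative
  functions.\<close>

lemma nn_integral_ac_part_le:
  assumes "sets \<mu> = sets borel" "N \<in> sets borel" "\<beta> \<in> borel_measurable borel"
    and dens: "density circle_measure (\<lambda>x. ennreal (\<beta> x)) = density (restrict_to_circle \<mu>) (indicator (- N))"
    and h: "h \<in> borel_measurable borel"
  shows "(\<integral>\<^sup>+x. ennreal (\<beta> x) * h x \<partial>circle_measure) \<le> (\<integral>\<^sup>+x. h x \<partial>\<mu>)"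
proof -
  have meas: "u \<in> borel_measurable \<mu>" if "u \<in> borel_measurable borel" for u :: "complex \<Rightarrow> ennreal"
    using that by (simp add: measurable_cong_sets[OF assms(1) refl])
  have "(\<integral>\<^sup>+x. ennreal (\<beta> x) * h x \<partial>circle_measure) = (\<integral>\<^sup>+x. h x \<partial>density circle_measure (\<lambda>x. ennreal (\<beta> x)))"
    using assms by (subst nn_integral_density) auto
  also have "\<dots> = (\<integral>\<^sup>+x. indicator (- N) x * h x \<partial>density \<mu> (indicator (sphere 0 1)))"
    unfolding dens restrict_to_circle_def
  proof (rule nn_integral_density)
    have "sets (density \<mu> (indicator (sphere 0 1))) = sets borel" using assms(1) by simp
    then have [simp]: "borel_measurable (density \<mu> (indicator (sphere 0 1))) = borel_measurable borel"
      by (rule measurable_cong_sets) simp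
    show "indicator (- N) \<in> borel_measurable (density \<mu> (indicator (sphere 0 1)))"
      "h \<in> borel_measurable (density \<mu> (indicator (sphere 0 1)))"
      using assms(2) h by simp_all
  qed
  also have "\<dots> = (\<integral>\<^sup>+x. indicator (sphere 0 1) x * (indicator (- N) x * h x) \<partial>\<mu>)"
  proof (rule nn_integral_density)
    show "(indicator (sphere 0 1) :: complex \<Rightarrow> ennreal) \<in> borel_measurable \<mu>"
      by (rule meas) (intro borel_measurable_indicator borel_closed closed_sphere)
    have "(indicator (- N) :: complex \<Rightarrow> ennreal) \<in> borel_measurable borel" using assms(2) by simp
    then show "(\<lambda>x. indicator (- N) x * h x) \<in> borel_measurable \<mu>"
      using h by (intro meas) simp
  qed
  also have "\<dots> \<le> (\<integral>\<^sup>+x. h x \<partial>\<mu>)"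
    by (intro nn_integral_mono) (auto simp: indicator_def)
  finally show ?thesis .
qed

lemma reverse_carleson_if_integrable:
  assumes pq: "0 < p" "p < q"
    and \<mu>: "sets \<mu> = sets borel" "finite_measure \<mu>" "N \<in> sets borel"
    and \<beta>: "\<beta> \<in> borel_measurable borel" "AE x in circle_measure. 0 < \<beta> x"
    and dens: "density circle_measure (\<lambda>x. ennreal (\<beta> x)) = density (restrict_to_circle \<mu>) (indicator (- N))"
    and fin: "(\<integral>\<^sup>+ x. ennreal ((1 / \<beta> x) powr (p / (q - p))) \<partial>circle_measure) < \<infinity>"
  shows "reverse_carleson p q \<mu>"
proof -
  interpret finite_measure \<mu> by fact
  define s where "s = p / (q - p)"
  have [measurable]: "\<beta> \<in> borel_measurable borel" by fact
  obtain K where K: "0 \<le> K" "(\<integral>\<^sup>+ x. ennreal ((1 / \<beta> x) powr s) \<partial>circle_measure) = ennreal K"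
    using fin unfolding s_def by (cases "\<integral>\<^sup>+ x. ennreal ((1 / \<beta> x) powr (p / (q - p))) \<partial>circle_measure") auto
  have "hardy_norm p f \<le> (1 + K) powr (1 / p) * Lq_norm \<mu> q f"
    if f: "f \<in> hardy p" "continuous_on (cball 0 1) f" for f
  proof -
    have hol: "f holomorphic_on ball 0 1" using f by (simp add: hardy_def)
    \<comment> \<open>The modulus of \<open>f\<close> is cut off outside the closed disc, which
      makes it a bounded Borel function on the plane.\<close>
    define g where "g z = indicator (cball 0 1) z * norm (f z)" for z :: complex
    have g0: "0 \<le> g z" for z by (simp add: g_def)
    have gp: "g z powr r = indicator (cball 0 1) z * norm (f z) powr r" if "0 < r" for r z
      using that by (auto simp: g_def indicator_def)
    have gm: "g \<in> borel_measurable borel"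
      unfolding g_def using borel_measurable_continuous_on_indicator[of "cball 0 1" "\<lambda>z. norm (f z)"] f(2)
      by (simp add: continuous_on_norm)
    note [measurable] = gm
    obtain B where B: "\<And>z. g z \<le> B" "0 \<le> B"
    proof -
      have "bounded (f ` cball 0 1)"
        by (intro compact_imp_bounded compact_continuous_image f(2)) simp
      then obtain B where "0 < B" "\<And>z. z \<in> cball 0 1 \<Longrightarrow> norm (f z) \<le> B"
        by (auto simp: bounded_pos)
      then show thesis by (intro that[of B]) (auto simp: g_def indicator_def)
    qed
    define E where "E = (\<integral>z. g z powr q \<partial>\<mu>)"
    have E0: "0 \<le> E" by (simp add: E_def integral_nonneg)
    have gm': "(\<lambda>z. g z powr q) \<in> borel_measurable \<mu>"
      by (simp add: measurable_cong_sets[OF \<mu>(1) refl])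
    have "integrable \<mu> (\<lambda>z. g z powr q)"
      by (rule integrable_const_bound[where B = "B powr q", OF _ gm'])
        (use B g0 pq in \<open>auto intro!: powr_mono2\<close>)
    then have E: "(\<integral>\<^sup>+z. ennreal (g z powr q) \<partial>\<mu>) = ennreal E"
      unfolding E_def by (intro nn_integral_eq_integral) auto
    have Lq: "Lq_norm \<mu> q f = E powr (1 / q)"
      using pq \<mu> f by (subst Lq_norm_eq_integral) (auto simp: E_def gp)
    have le: "(\<integral>\<^sup>+z. ennreal (\<beta> z) * ennreal (g z powr q) \<partial>circle_measure) \<le> ennreal E"
      unfolding E[symmetric] by (rule nn_integral_ac_part_le[OF \<mu>(1,3) \<beta>(1) dens]) simp
    define I where "I = (\<integral>z. g z powr p \<partial>circle_measure)"
    have hn: "hardy_norm p f = I powr (1 / p)"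
      using hardy_norm_eq_circle_mean[OF pq(1) hol f(2)] circle_mean_eq_integral[OF pq(1) f(2)] pq
      by (simp add: I_def gp)
    have I: "I = enn2real (\<integral>\<^sup>+z. ennreal (g z powr p) \<partial>circle_measure)"
      unfolding I_def by (rule integral_eq_nn_integral) auto
    show ?thesis
    \<comment> \<open>The weighted inequality divides by \<open>E\<close>. If \<open>E = 0\<close>,
      positivity of \<open>\<beta>\<close> forces \<open>f\<close> to vanish almost everywhere on
      the circle, and both norms are 0.\<close>
    proof (cases "E = 0")
      case True
      then have "(\<integral>\<^sup>+z. ennreal (\<beta> z) * ennreal (g z powr q) \<partial>circle_measure) = 0"
        using le by simp
      then have "AE z in circle_measure. ennreal (\<beta> z) * ennreal (g z powr q) = 0"
        by (subst (asm) nn_integral_0_iff_AE) auto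
      with \<beta>(2) have "AE z in circle_measure. ennreal (g z powr p) = 0"
        by eventually_elim auto
      then have "I = 0" unfolding I by (subst nn_integral_cong_AE[of _ "\<lambda>_. 0"]) auto
      then show ?thesis by (simp add: hn Lq)
    next
      case False
      then have "E > 0" using E0 by simp
      have "(\<integral>\<^sup>+z. ennreal (g z powr p) \<partial>circle_measure)
          \<le> (\<integral>\<^sup>+z. ennreal (E powr (p / q)) * (ennreal (1 / E) * (ennreal (\<beta> z) * ennreal (g z powr q)) + ennreal ((1 / \<beta> z) powr s)) \<partial>circle_measure)"
      proof (rule nn_integral_mono_AE)
        show "AE z in circle_measure. ennreal (g z powr p) \<le> ennreal (E powr (p / q)) *
            (ennreal (1 / E) * (ennreal (\<beta> z) * ennreal (g z powr q)) + ennreal ((1 / \<beta> z) powr s))"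
          using \<beta>(2)
        proof eventually_elim
          case (elim z)
          have "ennreal (g z powr p) \<le> ennreal (E powr (p / q) * (g z powr q * \<beta> z / E + (1 / \<beta> z) powr s))"
            unfolding s_def by (intro ennreal_leI powr_le_weighted_sum pq g0 elim \<open>E > 0\<close>)
          also have "\<dots> = ennreal (E powr (p / q)) *
              (ennreal (1 / E) * (ennreal (\<beta> z) * ennreal (g z powr q)) + ennreal ((1 / \<beta> z) powr s))"
            using elim \<open>E > 0\<close> by (simp add: ennreal_mult'[symmetric] ennreal_plus[symmetric] mult_ac del: ennreal_plus)
          finally show ?case .
        qed
      qed
      also have "\<dots> = ennreal (E powr (p / q)) *
          (ennreal (1 / E) * (\<integral>\<^sup>+z. ennreal (\<beta> z) * ennreal (g z powr q) \<partial>circle_measure) + ennreal K)"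
        by (simp add: nn_integral_cmult nn_integral_add K(2))
      \<comment> \<open>By \<open>le\<close> the first term contributes at most 1 after division by
        \<open>E\<close>, which produces the constant \<open>1 + K\<close>.\<close>
      also have "\<dots> \<le> ennreal (E powr (p / q)) * (ennreal (1 / E) * ennreal E + ennreal K)"
        by (intro mult_left_mono add_mono le) auto
      also have "\<dots> = ennreal (E powr (p / q) * (1 + K))"
        using \<open>E > 0\<close> K by (simp add: ennreal_mult'[symmetric] ennreal_plus[symmetric] ennreal_1[symmetric] del: ennreal_plus ennreal_1)
      finally have "I \<le> E powr (p / q) * (1 + K)"
        unfolding I using K(1) by (intro enn2real_leI) auto
      then have "hardy_norm p f \<le> (E powr (p / q) * (1 + K)) powr (1 / p)"
        unfolding hn using pq by (intro powr_mono2) (auto simp: I_def integral_nonneg)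
      also have "\<dots> = (1 + K) powr (1 / p) * Lq_norm \<mu> q f"
        using pq K by (simp add: Lq powr_mult powr_powr)
      finally show ?thesis .
    qed
  qed
  moreover have "0 < (1 + K) powr (1 / p)" using K by simp
  ultimately show ?thesis unfolding reverse_carleson_def by blast
qed

section \<open>Necessity\<close>

lemma sets_restrict_to_circle [simp]: "sets (restrict_to_circle \<mu>) = sets \<mu>"
  by (simp add: restrict_to_circle_def)

lemma integral_restrict_to_circle:
  fixes h :: "complex \<Rightarrow> real"
  assumes "sets \<mu> = sets borel" "h \<in> borel_measurable borel"
  shows "(\<integral>z. h z \<partial>restrict_to_circle \<mu>) = (\<integral>z. indicator (sphere 0 1) z * h z \<partial>\<mu>)"
proof -
  have "sphere (0::complex) 1 \<in> sets \<mu>" using assms(1) by (simp add: borel_closed)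
  moreover have "h \<in> borel_measurable \<mu>" using assms by (simp add: measurable_cong_sets[OF assms(1) refl])
  ultimately show ?thesis
    using integral_density[of h \<mu> "indicator (sphere 0 1)"]
    by (simp add: restrict_to_circle_def ennreal_indicator)
qed

lemma finite_measure_restrict_to_circle:
  assumes "finite_measure \<mu>" "sets \<mu> = sets borel"
  shows "finite_measure (restrict_to_circle \<mu>)"
proof (rule finite_measureI)
  interpret finite_measure \<mu> by fact
  have "sphere (0::complex) 1 \<in> sets \<mu>" using assms(2) by (simp add: borel_closed)
  then have "emeasure (restrict_to_circle \<mu>) (space \<mu>) = emeasure \<mu> (sphere 0 1 \<inter> space \<mu>)"
    unfolding restrict_to_circle_def by (rule emeasure_restricted) simp
  then show "emeasure (restrict_to_circle \<mu>) (space (restrict_to_circle \<mu>)) \<noteq> \<infinity>"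
    by (simp add: restrict_to_circle_def)
qed

lemma AE_restrict_to_circle_sphere:
  assumes "sets \<mu> = sets borel"
  shows "AE z in restrict_to_circle \<mu>. z \<in> sphere 0 1"
proof -
  have "sphere (0::complex) 1 \<in> sets \<mu>" using assms by (simp add: borel_closed)
  then show ?thesis
    unfolding restrict_to_circle_def by (subst AE_density) (auto simp: indicator_def)
qed

text \<open>Multiplying by \<open>z ^ N\<close> does not change the modulus on the circle, but removes the mass
  of the open disc in the limit.\<close>

lemma reverse_carleson_exp_Re_poly:
  assumes pq: "0 < p" "p < q" and \<mu>: "sets \<mu> = sets borel" "finite_measure \<mu>"
    and C: "0 < C" "\<And>f. f \<in> hardy p \<Longrightarrow> continuous_on (cball 0 1) f \<Longrightarrow> hardy_norm p f \<le> C * Lq_norm \<mu> q f"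
  shows "(\<integral>z. exp (Re (poly P z)) \<partial>circle_measure)
    \<le> C powr p * (\<integral>z. exp (q / p * Re (poly P z)) \<partial>restrict_to_circle \<mu>) powr (p / q)"
proof -
  interpret finite_measure \<mu> by fact
  \<comment> \<open>The division by \<open>p\<close> gives
    \<open>norm (f N z) powr p = exp (Re (poly P z))\<close> on the circle, and \<open>h\<close> is
    the matching \<open>q\<close>-th power there.\<close>
  define f where "f N z = z ^ N * exp (poly P z / of_real p)" for N :: nat and z
  define h where "h z = exp (q / p * Re (poly P z))" for z
  have cP: "continuous_on A (\<lambda>z. Re (poly P z))" for A by (intro continuous_intros)
  \<comment> \<open>\<open>0 < N\<close> matters at \<open>z = 0\<close>: there
    \<open>0 powr 0 = 0\<close>, whereas \<open>f 0 0\<close> is not 0.\<close>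
  have norm_f: "norm (f N z) powr r = norm z powr (N * r) * exp (r / p * Re (poly P z))"
    if "0 < N" "0 < r" for N r z
  proof (cases "z = 0")
    case False
    then have "norm (f N z) = norm z powr N * exp (Re (poly P z) / p)"
      by (simp add: f_def norm_mult norm_power powr_realpow)
    moreover have "exp (Re (poly P z) / p) powr r = exp (r / p * Re (poly P z))"
      by (simp add: powr_def)
    ultimately show ?thesis by (simp add: powr_mult powr_powr)
  qed (use that in \<open>simp add: f_def\<close>)
  define J where "J N = (\<integral>z. indicator (cball 0 1) z * norm (f N z) powr q \<partial>\<mu>)" for N
  have cont: "continuous_on A (f N)" for A N
    unfolding f_def using pq by (intro continuous_intros) auto
  have hol: "f N holomorphic_on A" for A N
    unfolding f_def using pq by (intro holomorphic_intros) auto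
  obtain B where B: "\<And>z. z \<in> cball 0 1 \<Longrightarrow> h z \<le> B"
  proof -
    have "continuous_on (cball 0 1) h" unfolding h_def by (intro continuous_intros cP)
    then have "bdd_above (h ` cball 0 1)"
      by (intro bounded_imp_bdd_above compact_imp_bounded compact_continuous_image) auto
    then show thesis by (auto simp: bdd_above_def intro: that)
  qed
  have hm: "h \<in> borel_measurable borel"
    unfolding h_def by (intro borel_measurable_continuous_onI continuous_intros cP)
  have "J \<longlonglongrightarrow> (\<integral>z. indicator (sphere 0 1) z * h z \<partial>\<mu>)"
    unfolding J_def
  proof (rule integral_dominated_convergence[where w = "\<lambda>_. \<bar>B\<bar>"])
    show "(\<lambda>z. indicator (sphere 0 1) z * h z) \<in> borel_measurable \<mu>"
      unfolding measurable_cong_sets[OF \<mu>(1) refl]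
      by (intro borel_measurable_times borel_measurable_indicator hm borel_closed) simp
    show "(\<lambda>z. indicator (cball 0 1) z * norm (f N z) powr q) \<in> borel_measurable \<mu>" for N
      unfolding measurable_cong_sets[OF \<mu>(1) refl]
      using pq by (intro borel_measurable_indicator_norm_powr cont borel_closed) auto
    show "AE z in \<mu>. (\<lambda>N. indicator (cball 0 1) z * norm (f N z) powr q) \<longlonglongrightarrow> indicator (sphere 0 1) z * h z"
    proof (rule AE_I2)
      fix z :: complex
      have eq: "(norm z powr q) ^ N * h z = norm (f N z) powr q" if "0 < N" for N
        using that pq by (auto simp: norm_f h_def powr_powr[symmetric] powr_realpow' mult.commute[of "real N"])
      show "(\<lambda>N. indicator (cball 0 1) z * norm (f N z) powr q) \<longlonglongrightarrow> indicator (sphere 0 1) z * h z"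
      proof (cases "norm z < 1")
        case True
        then have "norm z powr q < 1" using pq powr_less_mono2[of q "norm z" 1] by simp
        then have "(\<lambda>N. (norm z powr q) ^ N * h z) \<longlonglongrightarrow> 0 * h z"
          by (intro tendsto_intros LIMSEQ_power_zero) simp
        then have "(\<lambda>N. norm (f N z) powr q) \<longlonglongrightarrow> 0 * h z"
          by (rule Lim_transform_eventually)
            (auto intro!: eventually_mono[OF eventually_gt_at_top[of 0]] simp: eq)
        then show ?thesis using True by (simp add: indicator_def)
      next
        case False
        \<comment> \<open>On the circle both sides are \<open>h z\<close>; outside the closed disc
          both indicators vanish.\<close>
        show ?thesis
        proof (rule Lim_transform_eventually[OF tendsto_const])
          show "\<forall>\<^sub>F N in sequentially. indicator (sphere 0 1) z * h z = indicator (cball 0 1) z * norm (f N z) powr q"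
            using eventually_gt_at_top[of 0]
            by eventually_elim (use False in \<open>auto simp: indicator_def eq[symmetric]\<close>)
        qed
      qed
    qed
    show "AE z in \<mu>. norm (indicator (cball 0 1) z * norm (f N z) powr q) \<le> \<bar>B\<bar>" for N
    proof (rule AE_I2)
      fix z :: complex
      have "norm (f N z) powr q \<le> h z" if "norm z \<le> 1"
      proof -
        have "norm (f N z) \<le> exp (Re (poly P z) / p)"
          using that by (simp add: f_def norm_mult norm_power power_le_one mult_left_le_one_le)
        then have "norm (f N z) powr q \<le> exp (Re (poly P z) / p) powr q"
          using pq by (intro powr_mono2) auto
        then show ?thesis by (simp add: h_def powr_def mult_ac)
      qed
      then show "norm (indicator (cball 0 1) z * norm (f N z) powr q) \<le> \<bar>B\<bar>"
        using B[of z] by (auto simp: indicator_def)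
    qed
  qed simp
  then have J: "J \<longlonglongrightarrow> (\<integral>z. h z \<partial>restrict_to_circle \<mu>)"
    by (simp add: integral_restrict_to_circle[OF \<mu>(1) hm])
  define I where "I = (\<integral>z. exp (Re (poly P z)) \<partial>circle_measure)"
  have I0: "0 \<le> I" by (simp add: I_def integral_nonneg)
  have bound: "I \<le> C powr p * J N powr (p / q)" if "0 < N" for N
  proof -
    have "(\<integral>z. indicator (cball 0 1) z * norm (f N z) powr p \<partial>circle_measure) = I"
      unfolding I_def
    proof (rule integral_cong_AE)
      show "AE z in circle_measure. indicator (cball 0 1) z * norm (f N z) powr p = exp (Re (poly P z))"
        using AE_circle_measure_sphere by eventually_elim (use that pq in \<open>simp add: norm_f\<close>)
      show "(\<lambda>z. indicator (cball 0 1) z * norm (f N z) powr p) \<in> borel_measurable circle_measure"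
        using borel_measurable_indicator_norm_powr[of p "cball 0 1" "f N"] cont pq
        by (simp add: measurable_cong_sets[OF sets_circle_measure refl] borel_closed)
      show "(\<lambda>z. exp (Re (poly P z))) \<in> borel_measurable circle_measure"
        unfolding measurable_cong_sets[OF sets_circle_measure refl]
        by (intro borel_measurable_continuous_onI continuous_intros cP)
    qed
    then have "hardy_norm p (f N) = I powr (1 / p)"
      using hardy_norm_eq_circle_mean[OF pq(1) hol cont] circle_mean_eq_integral[OF pq(1) cont] by simp
    moreover have "Lq_norm \<mu> q (f N) = J N powr (1 / q)"
      unfolding J_def using pq \<mu>(1) cont by (intro Lq_norm_eq_integral) auto
    ultimately have "I powr (1 / p) \<le> C * J N powr (1 / q)"
      using C(2)[OF in_hardy_if_continuous[OF pq(1) hol cont] cont, of N] by simp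
    then have "(I powr (1 / p)) powr p \<le> (C * J N powr (1 / q)) powr p"
      using pq by (intro powr_mono2) auto
    then show ?thesis
      using pq C I0 by (simp add: powr_powr powr_mult)
  qed
  have "\<forall>\<^sub>F N in sequentially. I \<le> C powr p * J N powr (p / q)"
    using eventually_gt_at_top[of 0] by eventually_elim (rule bound)
  moreover have "(\<lambda>N. C powr p * J N powr (p / q)) \<longlonglongrightarrow> C powr p * (\<integral>z. h z \<partial>restrict_to_circle \<mu>) powr (p / q)"
    by (intro tendsto_intros tendsto_powr' J) (use pq in \<open>auto simp: J_def intro!: always_eventually integral_nonneg\<close>)
  ultimately show ?thesis
    unfolding I_def h_def by (intro tendsto_lowerbound) auto
qed

lemma integrable_circle_continuous:
  fixes g :: "complex \<Rightarrow> real"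
  assumes "finite_measure M" "sets M = sets borel" "AE z in M. z \<in> sphere 0 1"
    and "continuous_on UNIV g"
  shows "integrable M g"
proof -
  interpret finite_measure M by fact
  have "bounded (g ` sphere 0 1)"
    by (intro compact_imp_bounded compact_continuous_image continuous_on_subset[OF assms(4)]) auto
  then obtain B where "\<And>z. z \<in> sphere 0 1 \<Longrightarrow> norm (g z) \<le> B" unfolding bounded_iff by blast
  moreover have "g \<in> borel_measurable M"
    unfolding measurable_cong_sets[OF assms(2) refl] by (rule borel_measurable_continuous_onI[OF assms(4)])
  ultimately show ?thesis
    using assms(3) by (intro integrable_const_bound[where B = B]) (auto elim: eventually_mono)
qed

text \<open>Positivity allows \<open>ln (g z)\<close> to be approximated by
  \<open>Re (poly P z)\<close> uniformly on the circle up to \<open>e\<close>. Then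
  \<open>exp (Re (poly P z))\<close> matches \<open>g\<close> up to factors \<open>exp e\<close> and
  \<open>exp (-e)\<close>; each side of the inequality loses one factor \<open>exp e\<close>, and
  \<open>e\<close> tends to 0.\<close>

lemma reverse_carleson_pos_continuous:
  assumes pq: "0 < p" "p < q" and \<mu>: "sets \<mu> = sets borel" "finite_measure \<mu>"
    and C: "0 < C" "\<And>f. f \<in> hardy p \<Longrightarrow> continuous_on (cball 0 1) f \<Longrightarrow> hardy_norm p f \<le> C * Lq_norm \<mu> q f"
    and g: "continuous_on UNIV g" "\<And>z. 0 < g z"
  shows "(\<integral>z. g z \<partial>circle_measure)
    \<le> C powr p * (\<integral>z. g z powr (q / p) \<partial>restrict_to_circle \<mu>) powr (p / q)"
proof -
  let ?\<nu> = "restrict_to_circle \<mu>"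
  define A where "A = C powr p * (\<integral>z. g z powr (q / p) \<partial>?\<nu>) powr (p / q)"
  have int_m: "integrable circle_measure u" if "continuous_on UNIV u" for u :: "complex \<Rightarrow> real"
    by (rule integrable_circle_continuous[OF finite_measure_circle_measure sets_circle_measure AE_circle_measure_sphere that])
  have int_\<nu>: "integrable ?\<nu> u" if "continuous_on UNIV u" for u :: "complex \<Rightarrow> real"
    by (rule integrable_circle_continuous[OF finite_measure_restrict_to_circle _ AE_restrict_to_circle_sphere that])
      (use \<mu> in auto)
  have cP: "continuous_on UNIV (\<lambda>z. Re (poly P z))" for P by (intro continuous_intros)
  have cgp: "continuous_on UNIV (\<lambda>z. g z powr (q / p))"
    using g(2) by (intro continuous_on_powr g continuous_intros) (auto simp: less_imp_neq[THEN not_sym])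
  have "(\<integral>z. g z \<partial>circle_measure) \<le> exp (2 * e) * A" if "0 < e" for e
  proof -
    have "continuous_on (sphere 0 1) (\<lambda>z. ln (g z))"
      using g(2) by (intro continuous_on_ln continuous_on_subset[OF g(1)]) (auto simp: less_imp_neq[THEN not_sym])
    then obtain P where P: "\<And>z. z \<in> sphere 0 1 \<Longrightarrow> \<bar>ln (g z) - Re (poly P z)\<bar> < e"
      using Re_poly_dense_on_circle[OF _ \<open>0 < e\<close>] by metis
    have lower: "exp (-e) * g z \<le> exp (Re (poly P z))" if "z \<in> sphere 0 1" for z
    proof -
      have "exp (-e) * g z = exp (ln (g z) - e)" using g(2)[of z] by (simp add: exp_diff exp_minus field_simps)
      also have "\<dots> \<le> exp (Re (poly P z))" using P[OF that] by simp
      finally show ?thesis .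
    qed
    have upper: "exp (q / p * Re (poly P z)) \<le> exp (q / p * e) * g z powr (q / p)" if "z \<in> sphere 0 1" for z
    proof -
      have "q / p * Re (poly P z) \<le> q / p * (e + ln (g z))"
        using P[OF that] pq by (intro mult_left_mono) auto
      then have "exp (q / p * Re (poly P z)) \<le> exp (q / p * (e + ln (g z)))" by simp
      also have "\<dots> = exp (q / p * e) * g z powr (q / p)"
        using g(2)[of z] by (simp add: powr_def ring_distribs exp_add)
      finally show ?thesis .
    qed
    have "exp (-e) * (\<integral>z. g z \<partial>circle_measure) = (\<integral>z. exp (-e) * g z \<partial>circle_measure)" by simp
    also have "\<dots> \<le> (\<integral>z. exp (Re (poly P z)) \<partial>circle_measure)"
    proof (rule integral_mono_AE)
      show "AE z in circle_measure. exp (-e) * g z \<le> exp (Re (poly P z))"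
        using AE_circle_measure_sphere by eventually_elim (rule lower)
    qed (intro int_m continuous_intros g cP)+
    also have "\<dots> \<le> C powr p * (\<integral>z. exp (q / p * Re (poly P z)) \<partial>?\<nu>) powr (p / q)"
      by (rule reverse_carleson_exp_Re_poly[OF pq \<mu> C])
    also have "\<dots> \<le> C powr p * (exp (q / p * e) * (\<integral>z. g z powr (q / p) \<partial>?\<nu>)) powr (p / q)"
    proof (intro mult_left_mono powr_mono2)
      have "(\<integral>z. exp (q / p * Re (poly P z)) \<partial>?\<nu>) \<le> (\<integral>z. exp (q / p * e) * g z powr (q / p) \<partial>?\<nu>)"
      proof (rule integral_mono_AE)
        show "AE z in ?\<nu>. exp (q / p * Re (poly P z)) \<le> exp (q / p * e) * g z powr (q / p)"
          using AE_restrict_to_circle_sphere[OF \<mu>(1)] by eventually_elim (rule upper)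
      qed (intro int_\<nu> continuous_intros cgp cP)+
      then show "(\<integral>z. exp (q / p * Re (poly P z)) \<partial>?\<nu>) \<le> exp (q / p * e) * (\<integral>z. g z powr (q / p) \<partial>?\<nu>)"
        by simp
    qed (use pq in \<open>auto intro: integral_nonneg\<close>)
    \<comment> \<open>The outer power \<open>p / q\<close> turns \<open>exp (q / p * e)\<close> into
      \<open>exp e\<close>.\<close>
    also have "\<dots> = exp e * A"
      using pq by (simp add: A_def powr_mult integral_nonneg) (simp add: powr_def)
    finally have "exp e * (exp (-e) * (\<integral>z. g z \<partial>circle_measure)) \<le> exp e * (exp e * A)"
      by (intro mult_left_mono) auto
    then show ?thesis by (simp add: exp_minus mult.assoc[symmetric] flip: exp_add)
  qed
  then have "\<forall>\<^sub>F e in at_right 0. (\<integral>z. g z \<partial>circle_measure) \<le> exp (2 * e) * A"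
    by (simp add: eventually_at_filter)
  moreover have "((\<lambda>e. exp (2 * e) * A) \<longlongrightarrow> exp (2 * 0) * A) (at_right 0)"
    by (intro tendsto_intros)
  ultimately have "(\<integral>z. g z \<partial>circle_measure) \<le> exp (2 * 0) * A"
    by (intro tendsto_lowerbound) auto
  then show ?thesis by (simp add: A_def)
qed

text \<open>Positive continuous functions converge boundedly to \<open>u\<close> almost everywhere
  for both measures, so both sides pass to the limit by dominated convergence.\<close>

lemma reverse_carleson_bounded_borel:
  assumes pq: "0 < p" "p < q" and \<mu>: "sets \<mu> = sets borel" "finite_measure \<mu>"
    and C: "0 < C" "\<And>f. f \<in> hardy p \<Longrightarrow> continuous_on (cball 0 1) f \<Longrightarrow> hardy_norm p f \<le> C * Lq_norm \<mu> q f"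
    and u: "u \<in> borel_measurable borel" "\<And>z. 0 \<le> u z" "\<And>z. u z \<le> B"
  shows "(\<integral>z. u z \<partial>circle_measure)
    \<le> C powr p * (\<integral>z. u z powr (q / p) \<partial>restrict_to_circle \<mu>) powr (p / q)"
proof -
  let ?\<nu> = "restrict_to_circle \<mu>"
  have fin: "finite_measure circle_measure" "finite_measure ?\<nu>" and sb: "sets ?\<nu> = sets borel"
    using finite_measure_circle_measure finite_measure_restrict_to_circle \<mu> by auto
  \<comment> \<open>A common \<open>L\<close> is taken because the same sequence must converge
    almost everywhere for \<open>circle_measure\<close> and for \<open>?\<nu>\<close>, which may
    have a singular part.\<close>
  obtain L where L: "finite_measure L" "sets L = sets borel"
      "absolutely_continuous L circle_measure" "absolutely_continuous L ?\<nu>"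
    using ex_finite_measure_dominating[OF fin] sb by auto
  obtain g where g: "\<And>n. continuous_on UNIV (g n)" "\<And>n z. g n z \<in> {0..B}"
      "AE z in L. (\<lambda>n. g n z) \<longlonglongrightarrow> u z"
    using bounded_borel_AE_limit_continuous[OF L(1,2) u] by auto
  \<comment> \<open>The shift makes the nonnegative \<open>g n\<close> strictly positive without
    changing the limit.\<close>
  define G where "G n z = g n z + 1 / real (Suc n)" for n z
  have cG: "continuous_on UNIV (G n)" for n unfolding G_def by (intro continuous_intros g)
  have Gpos: "0 < G n z" for n z unfolding G_def using g(2)[of n z] by (simp add: add_nonneg_pos)
  have GB: "G n z \<le> B + 1" for n z
  proof -
    have "1 / real (Suc n) \<le> 1" by simp
    then show ?thesis using g(2)[of n z] unfolding G_def atLeastAtMost_iff by linarith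
  qed
  have lim: "AE z in M. (\<lambda>n. G n z) \<longlonglongrightarrow> u z" if "absolutely_continuous L M" "sets M = sets borel" for M
  proof -
    have "AE z in M. (\<lambda>n. g n z) \<longlonglongrightarrow> u z"
      using that L(2) g(3) by (intro absolutely_continuous_AE[of M L]) auto
    then show ?thesis
    proof eventually_elim
      case (elim z)
      have "(\<lambda>n. g n z + 1 / real (Suc n)) \<longlonglongrightarrow> u z + 0"
        using LIMSEQ_inverse_real_of_nat by (intro tendsto_intros elim) (simp add: inverse_eq_divide)
      then show ?case by (simp add: G_def)
    qed
  qed
  have conv: "(\<lambda>n. \<integral>z. G n z powr r \<partial>M) \<longlonglongrightarrow> (\<integral>z. u z powr r \<partial>M)"
    if M: "finite_measure M" "sets M = sets borel" "absolutely_continuous L M" and "0 < r" for M r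
  proof (rule integral_dominated_convergence[where w = "\<lambda>_. (B + 1) powr r"])
    interpret M: finite_measure M by fact
    have "G n \<in> borel_measurable borel" for n by (rule borel_measurable_continuous_onI[OF cG])
    then show "(\<lambda>z. G n z powr r) \<in> borel_measurable M" "(\<lambda>z. u z powr r) \<in> borel_measurable M" for n
      using u(1) by (simp_all add: measurable_cong_sets[OF M(2) refl])
    show "AE z in M. (\<lambda>n. G n z powr r) \<longlonglongrightarrow> u z powr r"
      using lim[OF M(3,2)]
      by eventually_elim (use Gpos \<open>0 < r\<close> in \<open>auto intro!: tendsto_powr' always_eventually less_imp_le\<close>)
    show "AE z in M. norm (G n z powr r) \<le> (B + 1) powr r" for n
      using Gpos GB \<open>0 < r\<close> by (intro AE_I2) (auto intro!: powr_mono2 simp: less_imp_le)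
    show "integrable M (\<lambda>_. (B + 1) powr r)" by simp
  qed
  \<comment> \<open>The exponent 1 recovers the plain integral from \<open>conv\<close>, as
    \<open>x powr 1 = x\<close> for nonnegative \<open>x\<close>.\<close>
  have "(\<lambda>n. \<integral>z. G n z powr 1 \<partial>circle_measure) \<longlonglongrightarrow> (\<integral>z. u z powr 1 \<partial>circle_measure)"
    using fin L by (intro conv) auto
  then have "(\<lambda>n. \<integral>z. G n z \<partial>circle_measure) \<longlonglongrightarrow> (\<integral>z. u z \<partial>circle_measure)"
    using Gpos u(2) by (simp add: less_imp_le)
  moreover have "(\<lambda>n. C powr p * (\<integral>z. G n z powr (q / p) \<partial>?\<nu>) powr (p / q))
      \<longlonglongrightarrow> C powr p * (\<integral>z. u z powr (q / p) \<partial>?\<nu>) powr (p / q)"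
    using pq fin L sb
    by (intro tendsto_intros tendsto_powr' conv) (auto intro!: always_eventually integral_nonneg)
  ultimately show ?thesis
    by (rule LIMSEQ_le) (use reverse_carleson_pos_continuous[OF pq \<mu> C cG Gpos] in auto)
qed

text \<open>The exponent \<open>s = p / (q - p)\<close> is the one for which \<open>u \<le> (1 / \<beta>) powr s\<close> gives \<open>u powr (q / p) * \<beta> \<le> u\<close>.\<close>

lemma reverse_carleson_truncated_bound:
  assumes pq: "0 < p" "p < q" and \<mu>: "sets \<mu> = sets borel" "finite_measure \<mu>"
    and C: "0 < C" "\<And>f. f \<in> hardy p \<Longrightarrow> continuous_on (cball 0 1) f \<Longrightarrow> hardy_norm p f \<le> C * Lq_norm \<mu> q f"
    and N: "N \<in> sets borel" "emeasure circle_measure N = 0"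
    and \<beta>: "\<beta> \<in> borel_measurable borel" "\<And>x. 0 \<le> \<beta> x"
    and dens: "density circle_measure (\<lambda>x. ennreal (\<beta> x)) = density (restrict_to_circle \<mu>) (indicator (- N))"
    and u: "u \<in> borel_measurable borel" "\<And>z. 0 \<le> u z" "\<And>z. u z \<le> B"
      "\<And>z. 0 < \<beta> z \<Longrightarrow> u z \<le> (1 / \<beta> z) powr (p / (q - p))"
  shows "(\<integral>z. u z \<partial>circle_measure) \<le> (C powr p) powr (q / (q - p))"
proof -
  let ?\<nu> = "restrict_to_circle \<mu>" and ?m = circle_measure
  interpret m: finite_measure ?m by (rule finite_measure_circle_measure)
  interpret \<nu>: finite_measure ?\<nu> by (rule finite_measure_restrict_to_circle[OF \<mu>(2,1)])
  have sb: "sets ?\<nu> = sets borel" using \<mu> by simp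
  note meas\<nu> = measurable_cong_sets[OF sb refl] and measm = measurable_cong_sets[OF sets_circle_measure refl]
  define \<kappa> where "\<kappa> = q / p"
  have \<kappa>: "1 < \<kappa>" using pq by (simp add: \<kappa>_def)
  have pw: "u z powr \<kappa> * \<beta> z \<le> u z" for z
  proof (cases "\<beta> z = 0 \<or> u z = 0")
    case False
    then have pos: "0 < \<beta> z" "0 < u z" using \<beta>(2)[of z] u(2)[of z] by auto
    have "p / (q - p) * (\<kappa> - 1) = 1" using pq by (simp add: \<kappa>_def field_simps)
    then have "((1 / \<beta> z) powr (p / (q - p))) powr (\<kappa> - 1) = (1 / \<beta> z) powr 1"
      by (simp only: powr_powr)
    then have "u z powr (\<kappa> - 1) \<le> (1 / \<beta> z) powr 1"
      using powr_mono2[OF _ u(2) u(4)[OF pos(1)], of "\<kappa> - 1"] \<kappa> by simp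
    then have "u z powr (\<kappa> - 1) * \<beta> z \<le> 1" using pos by (simp add: field_simps)
    then have "u z * (u z powr (\<kappa> - 1) * \<beta> z) \<le> u z * 1"
      using pos by (intro mult_left_mono) auto
    moreover have "u z powr \<kappa> = u z * u z powr (\<kappa> - 1)"
      using pos powr_add[of "u z" 1 "\<kappa> - 1"] by simp
    ultimately show ?thesis by (simp add: mult.assoc)
  qed (use u(2)[of z] \<kappa> in auto)
  have uk: "(\<lambda>z. u z powr \<kappa>) \<in> borel_measurable borel" using u(1) by simp
  \<comment> \<open>The absolutely continuous part of \<open>?\<nu>\<close> in its two forms: with
    density \<open>\<beta>\<close>, and as \<open>?\<nu>\<close> off \<open>N\<close>.\<close>
  define D where "D = density ?m (\<lambda>x. ennreal (\<beta> x))"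
  have D: "D = density ?\<nu> (\<lambda>x. ennreal (indicator (- N) x))"
    unfolding D_def dens by (simp add: ennreal_indicator)
  have indN: "(indicator (- N) :: complex \<Rightarrow> real) \<in> borel_measurable borel" using N(1) by simp
  have uB: "AE z in M. norm (u z powr \<kappa>) \<le> B powr \<kappa>" for M
    using u(2,3) \<kappa> by (intro AE_I2) (auto intro!: powr_mono2)
  have "integrable ?\<nu> (\<lambda>z. u z powr \<kappa>)"
    using uk by (intro \<nu>.integrable_const_bound[OF uB]) (simp add: meas\<nu>)
  then have "integrable ?\<nu> (\<lambda>z. indicator (- N) z *\<^sub>R (u z powr \<kappa>))"
    using N(1) sb by (intro integrable_mult_indicator) auto
  then have "integrable D (\<lambda>z. u z powr \<kappa>)"
    unfolding D using uk indN by (subst integrable_density) (auto simp: meas\<nu>)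
  then have int\<beta>: "integrable ?m (\<lambda>z. \<beta> z * u z powr \<kappa>)"
    unfolding D_def using uk \<beta> by (subst (asm) integrable_density) (auto simp: measm)
  have AEN: "AE z in ?m. z \<notin> N" using N by (auto intro!: AE_not_in simp: null_sets_def)
  define I where "I = (\<integral>z. u z \<partial>?m)"
  have intu: "integrable ?m u"
    using u by (intro m.integrable_const_bound[where B = B]) (auto simp: measm)
  \<comment> \<open>Cutting \<open>u\<close> off on \<open>N\<close> leaves the integral against
    \<open>?m\<close> unchanged but removes the singular part of \<open>?\<nu>\<close> from the
    right-hand side.\<close>
  have "I = (\<integral>z. indicator (- N) z * u z \<partial>?m)"
    unfolding I_def using AEN u(1) indN by (intro integral_cong_AE) (auto simp: measm)
  also have "\<dots> \<le> C powr p * (\<integral>z. (indicator (- N) z * u z) powr (q / p) \<partial>?\<nu>) powr (p / q)"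
  proof (rule reverse_carleson_bounded_borel[OF pq \<mu> C])
    show "(\<lambda>z. indicator (- N) z * u z) \<in> borel_measurable borel" using indN u(1) by simp
    show "0 \<le> indicator (- N) z * u z" for z using u(2) by (simp add: indicator_def)
    show "indicator (- N) z * u z \<le> B" for z
      using u(2,3)[of z] by (auto simp: indicator_def)
  qed
  also have "(\<integral>z. (indicator (- N) z * u z) powr (q / p) \<partial>?\<nu>) = (\<integral>z. indicator (- N) z *\<^sub>R (u z powr \<kappa>) \<partial>?\<nu>)"
    using \<kappa> by (intro Bochner_Integration.integral_cong) (auto simp: indicator_def \<kappa>_def)
  also have "\<dots> = (\<integral>z. u z powr \<kappa> \<partial>D)"
    unfolding D using uk indN by (subst integral_density) (auto simp: meas\<nu>)
  also have "\<dots> = (\<integral>z. \<beta> z * u z powr \<kappa> \<partial>?m)"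
    unfolding D_def using uk \<beta> by (subst integral_density) (auto simp: measm)
  also have "C powr p * (\<dots>) powr (p / q) \<le> C powr p * I powr (p / q)"
  proof (intro mult_left_mono powr_mono2)
    show "(\<integral>z. \<beta> z * u z powr \<kappa> \<partial>?m) \<le> I"
      unfolding I_def using int\<beta> intu pw by (intro integral_mono) (auto simp: mult.commute)
  qed (use pq \<beta>(2) in \<open>auto intro!: integral_nonneg\<close>)
  finally have le: "I \<le> C powr p * I powr (p / q)" .
  \<comment> \<open>\<open>I\<close> occurs on both sides of \<open>le\<close>. The bound
    \<open>B\<close> makes it finite, so for \<open>I > 0\<close> one may divide by
    \<open>I powr (p / q)\<close>; the exponent \<open>q / (q - p)\<close> inverts
    \<open>1 - p / q\<close>.\<close>
  have "I \<le> (C powr p) powr (q / (q - p))"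
  proof (cases "I = 0")
    case False
    then have I: "0 < I" using u(2) by (simp add: I_def less_le integral_nonneg)
    have "I powr (1 - p / q) * I powr (p / q) \<le> C powr p * I powr (p / q)"
      using le I by (simp flip: powr_add)
    then have "I powr (1 - p / q) \<le> C powr p" using I by simp
    then have "(I powr (1 - p / q)) powr (q / (q - p)) \<le> (C powr p) powr (q / (q - p))"
      using pq by (intro powr_mono2) auto
    moreover have "(1 - p / q) * (q / (q - p)) = 1" using pq by (simp add: field_simps)
    then have "(I powr (1 - p / q)) powr (q / (q - p)) = I" using I by (simp only: powr_powr powr_one)
    ultimately show ?thesis by simp
  qed simp
  then show ?thesis by (simp add: I_def)
qed

text \<open>Truncations of \<open>(1 / \<beta> x) powr (p / (q - p))\<close> have integrals bounded
  by one constant. On the zeros of \<open>\<beta>\<close> they equal \<open>n\<close>, so these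
  zeros form a null set; monotone convergence then bounds the full integral.\<close>

lemma integrable_if_reverse_carleson:
  assumes pq: "0 < p" "p < q" and \<mu>: "sets \<mu> = sets borel" "finite_measure \<mu>"
    and rc: "reverse_carleson p q \<mu>"
    and N: "N \<in> sets borel" "emeasure circle_measure N = 0"
    and \<beta>: "\<beta> \<in> borel_measurable borel" "\<And>x. 0 \<le> \<beta> x"
    and dens: "density circle_measure (\<lambda>x. ennreal (\<beta> x)) = density (restrict_to_circle \<mu>) (indicator (- N))"
  shows "AE x in circle_measure. 0 < \<beta> x"
    and "(\<integral>\<^sup>+ x. ennreal ((1 / \<beta> x) powr (p / (q - p))) \<partial>circle_measure) < \<infinity>"
proof -
  let ?m = circle_measure
  interpret m: finite_measure ?m by (rule finite_measure_circle_measure)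
  note [measurable] = \<beta>(1)
  obtain C where C: "0 < C"
      "\<And>f. f \<in> hardy p \<Longrightarrow> continuous_on (cball 0 1) f \<Longrightarrow> hardy_norm p f \<le> C * Lq_norm \<mu> q f"
    using rc unfolding reverse_carleson_def by auto
  define K where "K = (C powr p) powr (q / (q - p))"
  \<comment> \<open>Since \<open>1 / 0 = 0\<close>, the zeros of \<open>\<beta>\<close> are treated
    apart: the value \<open>real n\<close> there is the truncation of infinity.\<close>
  define u where "u n z = (if \<beta> z = 0 then real n else min (real n) ((1 / \<beta> z) powr (p / (q - p))))" for n z
  have um [measurable]: "u n \<in> borel_measurable borel" for n unfolding u_def by measurable
  have u0: "0 \<le> u n z" "u n z \<le> real n" for n z by (auto simp: u_def)
  have bound: "(\<integral>\<^sup>+z. ennreal (u n z) \<partial>?m) \<le> ennreal K" for n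
  proof -
    have "integrable ?m (u n)" using u0 by (intro m.integrable_const_bound[where B = "real n"]) auto
    then have "(\<integral>\<^sup>+z. ennreal (u n z) \<partial>?m) = ennreal (\<integral>z. u n z \<partial>?m)"
      using u0 by (intro nn_integral_eq_integral) auto
    also have "\<dots> \<le> ennreal K"
      unfolding K_def
      by (intro ennreal_leI reverse_carleson_truncated_bound[OF pq \<mu> C N \<beta> dens um u0]) (auto simp: u_def)
    finally show ?thesis .
  qed
  define Z where "Z = {z. \<beta> z = 0}"
  have Z: "Z \<in> sets ?m" unfolding Z_def by simp
  have "real n * measure ?m Z \<le> K" for n
  proof -
    have "ennreal (real n * measure ?m Z) = (\<integral>\<^sup>+z. ennreal (real n) * indicator Z z \<partial>?m)"
      using Z by (simp add: nn_integral_cmult_indicator m.emeasure_eq_measure ennreal_mult')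
    also have "\<dots> \<le> (\<integral>\<^sup>+z. ennreal (u n z) \<partial>?m)"
      by (intro nn_integral_mono) (auto simp: Z_def u_def indicator_def)
    finally have "ennreal (real n * measure ?m Z) \<le> ennreal K" using bound order_trans by blast
    then show ?thesis by (simp add: K_def)
  qed
  then have "measure ?m Z = 0"
    using reals_Archimedean3[of "measure ?m Z" ] by (metis not_le measure_nonneg less_le)
  then have "AE z in ?m. z \<notin> Z"
    using Z by (intro AE_not_in) (simp add: null_sets_def m.emeasure_eq_measure)
  then show pos: "AE z in ?m. 0 < \<beta> z"
    by eventually_elim (use \<beta>(2) in \<open>auto simp: Z_def less_le\<close>)
  \<comment> \<open>Where \<open>\<beta>\<close> is positive, a truncation at a high enough level
    already equals the function.\<close>
  have "(\<integral>\<^sup>+ z. ennreal ((1 / \<beta> z) powr (p / (q - p))) \<partial>?m) \<le> (\<integral>\<^sup>+ z. (SUP n. ennreal (u n z)) \<partial>?m)"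
  proof (rule nn_integral_mono_AE)
    show "AE z in ?m. ennreal ((1 / \<beta> z) powr (p / (q - p))) \<le> (SUP n. ennreal (u n z))"
      using pos
    proof eventually_elim
      case (elim z)
      obtain n :: nat where "(1 / \<beta> z) powr (p / (q - p)) \<le> real n" using real_arch_simple by blast
      then have "ennreal ((1 / \<beta> z) powr (p / (q - p))) = ennreal (u n z)"
        using elim by (simp add: u_def min_def)
      then show ?case by (auto intro: SUP_upper2[of n])
    qed
  qed
  also have "\<dots> = (SUP n. \<integral>\<^sup>+ z. ennreal (u n z) \<partial>?m)"
  proof (rule nn_integral_monotone_convergence_SUP)
    show "incseq (\<lambda>n z. ennreal (u n z))"
      by (auto simp: incseq_def le_fun_def u_def intro!: ennreal_leI)
  qed simp
  also have "\<dots> \<le> ennreal K" by (intro SUP_least bound)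
  finally show "(\<integral>\<^sup>+ z. ennreal ((1 / \<beta> z) powr (p / (q - p))) \<partial>?m) < \<infinity>"
    by (simp add: le_less_trans)
qed

section \<open>Both implications combined for the density of the absolutely continuous part\<close>

theorem theorem3p5:
  fixes p q :: real and \<mu> :: "complex measure" and \<beta> :: "complex \<Rightarrow> real"
  assumes "0 < p" "p < q"
    and "sets \<mu> = sets borel" "finite_measure \<mu>" "emeasure \<mu> (- cball 0 1) = 0"
    and "is_ac_part_density circle_measure (restrict_to_circle \<mu>) \<beta>"
  shows "reverse_carleson p q \<mu> \<longleftrightarrow>
           (AE x in circle_measure. 0 < \<beta> x) \<and>
           (\<integral>\<^sup>+ x. ennreal ((1 / \<beta> x) powr (p / (q - p))) \<partial>circle_measure) < \<infinity>"
proof -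
  have \<beta>: "\<beta> \<in> borel_measurable borel" "\<And>x. 0 \<le> \<beta> x"
    using assms(6) by (auto simp: is_ac_part_density_def)
  \<comment> \<open>The same null set carries the singular part in both directions.\<close>
  obtain N where N: "N \<in> sets borel" "emeasure circle_measure N = 0"
      "density circle_measure (\<lambda>x. ennreal (\<beta> x)) = density (restrict_to_circle \<mu>) (indicator (- N))"
    using ac_part_eq_restriction[OF assms(6)] assms(3) by auto
  show ?thesis
    using reverse_carleson_if_integrable[OF assms(1-4) N(1) \<beta>(1) _ N(3)]
      integrable_if_reverse_carleson[OF assms(1-4) _ N(1,2) \<beta> N(3)] by blast
qed

end
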